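(* Let $n\in\mathbb{N}$, let $\alpha$ be a composition of $n$ and let $T$ be a linear extension of $D(\alpha)$. Then the number of $\pi\in S_n'$ with $\alpha_\pi=\alpha$ and $T_\pi=T$ equals \[\prod_{(i,j)\in D(\alpha)}h_\alpha(i,j).\]
   Context: A "permutation" may be any finite sequence of distinct integers. West's stack-sorting map $s$: read the input left to right with an initially empty stack; repeatedly, if the input is nonempty and either the stack is empty or the top of the stack is greater than the next input entry, push the next entry; otherwise pop the top of the stack and append it to the output; stop when input and stack are empty. $\operatorname{sc}(\pi)$ is the least $k\ge0$ with $s^k(\pi)$ increasing. $S_n'$ is the set of permutations of $\{0,1,\dots,n\}$ whose last entry is $0$. For $\pi\in S_n'$ and $1\le i\le\operatorname{sc}(\pi)$ let $\sigma=s^{i-1}(\pi)$. Let $c_{\pi,i,1}$ be the maximum of the entries of $\sigma$ strictly left of $0$; for $j\ge2$, as long as some entry of $\sigma$ lies strictly between $c_{\pi,i,j-1}$ and $0$, let $c_{\pi,i,j}$ be the maximum of those entries; otherwise stop. This gives $C_{\pi,i}=(c_{\pi,i,1},\dots,c_{\pi,i,|C_{\pi,i}|})$. Blocks: $b_{\pi,i,1}$ is the contiguous subsequence of $\sigma$ strictly before $c_{\pi,i,1}$, and $b_{\pi,i,j}$ ($j\ge2$) the contiguous subsequence strictly between $c_{\pi,i,j-1}$ and $c_{\pi,i,j}$. Every $x\in[n]$ equals $c_{\pi,i,j}$ for a unique pair $(i,j)$; set $\operatorname{col}_\pi(x)=i$, $\operatorname{colpos}_\pi(x)=j$. If $\operatorname{col}_\pi(x)>1$,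 there is a unique $j$ with $x=\max(b_{\pi,\operatorname{col}_\pi(x)-1,j})$, and $\operatorname{leftof}_\pi(x):=c_{\pi,\operatorname{col}_\pi(x)-1,j}$. Recursively $\operatorname{row}_\pi(x)=\operatorname{colpos}_\pi(x)$ if $\operatorname{col}_\pi(x)=1$, and $\operatorname{row}_\pi(x)=\operatorname{row}_\pi(\operatorname{leftof}_\pi(x))$ otherwise. The composition $\alpha_\pi=(|\{x\in[n]:\operatorname{row}_\pi(x)=j\}|)_{j=1}^{|C_{\pi,1}|}$. For a composition $\alpha=(\alpha_1,\dots,\alpha_m)$ of $n$, $D(\alpha)=\{(i,j)\in\mathbb{N}^2: 1\le j\le m,\ i\le\alpha_j\}$, with partial order $(a,b)\ge_D(c,d)$ iff $a\le c$ and $b\le d$. $T_\pi:[n]\to D(\alpha_\pi)$, $T_\pi(x)=(\operatorname{col}_\pi(x),\operatorname{row}_\pi(x))$. A linear extension of $D(\alpha)$ is a bijection $T:[n]\to D(\alpha)$ such that $T(x)\ge_D T(y)$ implies $x\ge y$. Hook length: $h_\alpha(1,j)=1$; for $i>1$, letting $r=\max\{j'<j:\alpha_{j'}\ge i-1\}$ (with $r=0$ if the set is empty), $h_\alpha(i,j)=|\{(i',j')\in D(\alpha): i'\le i-1,\ r<j'\le j\}|$. *)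

theory Defs
  imports Main "HOL-Combinatorics.Multiset_Permutations"
begin

text \<open>
  West's stack-sorting map. The first argument is the stack (top first), the second the remaining
  input; popped entries are emitted in order, so the result is the output.
\<close>

function stack_run :: "'a::linorder list \<Rightarrow> 'a list \<Rightarrow> 'a list" where
  "stack_run [] [] = []"
| "stack_run [] (x # xs) = stack_run [x] xs"
| "stack_run (t # st) [] = t # stack_run st []"
| "stack_run (t # st) (x # xs) =
     (if t > x then stack_run (x # t # st) xs else t # stack_run st (x # xs))"
  by pat_completeness auto
termination
  by (relation "measure (\<lambda>(st, xs). length st + 2 * length xs)") auto

definition stack_sort :: "'a::linorder list \<Rightarrow> 'a list" where
  "stack_sort xs = stack_run [] xs"

definition sc :: "'a::linorder list \<Rightarrow> nat" where
  "sc xs = (LEAST k. sorted_wrt (<) ((stack_sort ^^ k) xs))"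

definition S' :: "nat \<Rightarrow> nat list set" where
  "S' n = {\<pi> \<in> permutations_of_set {0..n}. last \<pi> = 0}"

definition before :: "'a \<Rightarrow> 'a list \<Rightarrow> 'a list" where
  "before x xs = takeWhile (\<lambda>y. y \<noteq> x) xs"

definition after :: "'a \<Rightarrow> 'a list \<Rightarrow> 'a list" where
  "after x xs = tl (dropWhile (\<lambda>y. y \<noteq> x) xs)"

lemma length_after_less: "xs \<noteq> [] \<Longrightarrow> length (after x xs) < length xs"
proof -
  assume "xs \<noteq> []"
  moreover have "length (dropWhile (\<lambda>y. y \<noteq> x) xs) \<le> length xs"
    by (rule length_dropWhile_le)
  moreover have "length xs > 0"
    using \<open>xs \<noteq> []\<close> by simp
  ultimately show ?thesis
    unfolding after_def length_tl by linarith
qed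

function champions :: "nat list \<Rightarrow> nat list" where
  "champions xs =
     (if xs = [] then [] else Max (set xs) # champions (after (Max (set xs)) xs))"
  by pat_completeness auto
termination
  by (relation "measure length") (auto simp: length_after_less)

declare champions.simps [simp del]

text \<open>
  All positions, columns and rows below are counted from 1, whereas list access is 0-based.
\<close>

definition sigma :: "nat list \<Rightarrow> nat \<Rightarrow> nat list" where
  "sigma \<pi> i = (stack_sort ^^ (i - 1)) \<pi>"

definition C_seq :: "nat list \<Rightarrow> nat \<Rightarrow> nat list" where
  "C_seq \<pi> i = champions (before 0 (sigma \<pi> i))"

definition c_entry :: "nat list \<Rightarrow> nat \<Rightarrow> nat \<Rightarrow> nat" where
  "c_entry \<pi> i j = C_seq \<pi> i ! (j - 1)"

definition block :: "nat list \<Rightarrow> nat \<Rightarrow> nat \<Rightarrow> nat list" where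
  "block \<pi> i j =
     (if j = 1 then before (c_entry \<pi> i 1) (sigma \<pi> i)
      else before (c_entry \<pi> i j) (after (c_entry \<pi> i (j - 1)) (sigma \<pi> i)))"

definition coords :: "nat list \<Rightarrow> nat \<Rightarrow> nat \<times> nat" where
  "coords \<pi> x =
     (THE (i, j). i \<in> {1..sc \<pi>} \<and> j \<in> {1..length (C_seq \<pi> i)} \<and> x = c_entry \<pi> i j)"

definition col :: "nat list \<Rightarrow> nat \<Rightarrow> nat" where
  "col \<pi> x = fst (coords \<pi> x)"

definition colpos :: "nat list \<Rightarrow> nat \<Rightarrow> nat" where
  "colpos \<pi> x = snd (coords \<pi> x)"

definition leftof :: "nat list \<Rightarrow> nat \<Rightarrow> nat" where
  "leftof \<pi> x =
     (let i = col \<pi> x - 1 in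
      c_entry \<pi> i (THE j. j \<in> {1..length (C_seq \<pi> i)} \<and>
                     block \<pi> i j \<noteq> [] \<and> x = Max (set (block \<pi> i j))))"

partial_function (tailrec) row :: "nat list \<Rightarrow> nat \<Rightarrow> nat" where
  "row \<pi> x = (if col \<pi> x = 1 then colpos \<pi> x else row \<pi> (leftof \<pi> x))"

text \<open>
  For \<open>\<pi>\<close> in \<open>S' n\<close> we have \<open>length \<pi> - 1 = n\<close>.
\<close>

definition alpha :: "nat list \<Rightarrow> nat list" where
  "alpha \<pi> =
     map (\<lambda>j. card {x \<in> {1..length \<pi> - 1}. row \<pi> x = j}) [1..<length (C_seq \<pi> 1) + 1]"

definition T_of :: "nat list \<Rightarrow> nat \<Rightarrow> nat \<times> nat" where
  "T_of \<pi> x = (col \<pi> x, row \<pi> x)"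

definition composition_of :: "nat list \<Rightarrow> nat \<Rightarrow> bool" where
  "composition_of \<alpha> n \<longleftrightarrow> (\<forall>a \<in> set \<alpha>. a \<ge> 1) \<and> sum_list \<alpha> = n"

definition diagram :: "nat list \<Rightarrow> (nat \<times> nat) set" where
  "diagram \<alpha> = {(i, j). 1 \<le> j \<and> j \<le> length \<alpha> \<and> 1 \<le> i \<and> i \<le> \<alpha> ! (j - 1)}"

definition ge_D :: "nat \<times> nat \<Rightarrow> nat \<times> nat \<Rightarrow> bool" where
  "ge_D p q \<longleftrightarrow> fst p \<le> fst q \<and> snd p \<le> snd q"

definition linear_extension :: "nat \<Rightarrow> nat list \<Rightarrow> (nat \<Rightarrow> nat \<times> nat) \<Rightarrow> bool" where
  "linear_extension n \<alpha> T \<longleftrightarrow>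
     bij_betw T {1..n} (diagram \<alpha>) \<and>
     (\<forall>x \<in> {1..n}. \<forall>y \<in> {1..n}. ge_D (T x) (T y) \<longrightarrow> x \<ge> y)"

definition hook_bound :: "nat list \<Rightarrow> nat \<Rightarrow> nat \<Rightarrow> nat" where
  "hook_bound \<alpha> i j =
     (let R = {j'. 1 \<le> j' \<and> j' < j \<and> \<alpha> ! (j' - 1) \<ge> i - 1}
      in if R = {} then 0 else Max R)"

definition hook :: "nat list \<Rightarrow> nat \<Rightarrow> nat \<Rightarrow> nat" where
  "hook \<alpha> i j =
     (if i = 1 then 1
      else card {(i', j') \<in> diagram \<alpha>. i' \<le> i - 1 \<and> hook_bound \<alpha> i j < j' \<and> j' \<le> j})"

end

theory Submission
  imports Defs
begin

text \<open>
  West's map sends \<open>us m vs\<close>, where \<open>m\<close> is the greatest entry, to \<open>s(us) s(vs) m\<close>. Hence, for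
  \<open>a < b\<close>, the entry \<open>b\<close> precedes \<open>a\<close> in \<open>s(w)\<close> iff some \<open>c > b\<close> lies between \<open>b\<close> and \<open>a\<close> in
  \<open>w\<close>, and deleting the least positive entry \<open>z\<close> of a word ending in \<open>0\<close> commutes with \<open>s\<close>. So
  the cells of the other entries do not depend on \<open>z\<close>, and one counts words by inserting the
  positive entries in decreasing order.

  Sorting keeps the blocks in order, which makes every entry that is not yet a champion pass on to
  the first row, from its present row on, that extends to the next column. If \<open>z\<close> is inserted
  directly in front of a positive entry \<open>y\<close>, then \<open>z\<close> and \<open>y\<close> share a row as long as both are
  active, and \<open>z\<close> ends in an addable cell whose hook contains the cell of \<open>y\<close>. The hooks of
  different addable cells are disjoint, so the insertions placing \<open>z\<close> in a given cell correspond
  to the cells of the hook of that cell.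
\<close>

section \<open>Precedence in words\<close>

fun precedes :: "'a list \<Rightarrow> 'a \<Rightarrow> 'a \<Rightarrow> bool" where
  "precedes [] x y \<longleftrightarrow> False"
| "precedes (u # us) x y \<longleftrightarrow> x = u \<and> y \<in> set us \<or> precedes us x y"

lemma precedes_append:
  "precedes (us @ vs) x y \<longleftrightarrow> precedes us x y \<or> precedes vs x y \<or> x \<in> set us \<and> y \<in> set vs"
  by (induction us) auto

lemma precedes_in_set: "precedes w x y \<Longrightarrow> x \<in> set w \<and> y \<in> set w"
  by (induction w) auto

lemma precedes_irrefl: "distinct w \<Longrightarrow> \<not> precedes w x x"
  by (induction w) auto

lemma precedes_trans: "distinct w \<Longrightarrow> precedes w x y \<Longrightarrow> precedes w y z \<Longrightarrow> precedes w x z"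
  by (induction w) (auto dest: precedes_in_set)

lemma precedes_total:
  "x \<in> set w \<Longrightarrow> y \<in> set w \<Longrightarrow> x \<noteq> y \<Longrightarrow> precedes w x y \<or> precedes w y x"
  by (induction w) auto

lemma precedes_last:
  "distinct w \<Longrightarrow> x \<in> set w \<Longrightarrow> x \<noteq> last w \<Longrightarrow> precedes w x (last w)"
  by (induction w) (auto split: if_splits)

lemma precedes_removeAll:
  "precedes (removeAll z w) x y \<longleftrightarrow> precedes w x y \<and> x \<noteq> z \<and> y \<noteq> z"
  by (induction w) (auto dest: precedes_in_set)

lemma sorted_wrt_iff_precedes: "sorted_wrt P w \<longleftrightarrow> (\<forall>x y. precedes w x y \<longrightarrow> P x y)"
  by (induction w) (auto dest: precedes_in_set)

lemma precedes_pivot_iff: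
  assumes "distinct (us @ c # vs)"
  shows "precedes (us @ c # vs) x c \<longleftrightarrow> x \<in> set us"
    and "precedes (us @ c # vs) c x \<longleftrightarrow> x \<in> set vs"
  using assms by (auto simp: precedes_append dest: precedes_in_set)

lemma before_pivot [simp]: "c \<notin> set us \<Longrightarrow> before c (us @ c # vs) = us"
  unfolding before_def by (subst takeWhile_append2) auto

lemma after_pivot [simp]: "c \<notin> set us \<Longrightarrow> after c (us @ c # vs) = vs"
  unfolding after_def by (subst dropWhile_append2) auto

lemma before_append_after: "c \<in> set w \<Longrightarrow> before c w @ c # after c w = w"
  by (metis split_list_first before_pivot after_pivot)

lemma pivot_notin_before: "c \<notin> set (before c w)"
  unfolding before_def by (auto dest: set_takeWhileD)

lemma distinct_before: "distinct w \<Longrightarrow> distinct (before c w)"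
  unfolding before_def by simp

lemma distinct_after: "distinct w \<Longrightarrow> distinct (after c w)"
  unfolding after_def by (simp add: distinct_tl)

lemma set_before: "distinct w \<Longrightarrow> c \<in> set w \<Longrightarrow> set (before c w) = {x. precedes w x c}"
  using precedes_pivot_iff(1)[of "before c w" c "after c w"] by (simp add: before_append_after)

lemma set_after: "distinct w \<Longrightarrow> c \<in> set w \<Longrightarrow> set (after c w) = {x. precedes w c x}"
  using precedes_pivot_iff(2)[of "before c w" c "after c w"] by (simp add: before_append_after)

lemma
  assumes "distinct w" "c \<in> set w"
  shows precedes_before: "precedes (before c w) x y \<longleftrightarrow> precedes w x y \<and> precedes w y c"
    and precedes_after: "precedes (after c w) x y \<longleftrightarrow> precedes w x y \<and> precedes w c x"
proof -
  let ?w = "before c w @ c # after c w"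
  have "distinct ?w" using assms by (simp add: before_append_after)
  then have "precedes ?w x y \<and> y \<in> set (before c w) \<longleftrightarrow> precedes (before c w) x y"
    "precedes ?w x y \<and> x \<in> set (after c w) \<longleftrightarrow> precedes (after c w) x y"
    by (auto simp: precedes_append dest: precedes_in_set)
  then show "precedes (before c w) x y \<longleftrightarrow> precedes w x y \<and> precedes w y c"
    "precedes (after c w) x y \<longleftrightarrow> precedes w x y \<and> precedes w c x"
    using assms by (simp_all add: before_append_after set_before set_after)
qed

section \<open>The stack-sorting map\<close>

lemma mset_stack_sort: "mset (stack_sort w) = mset w"
proof -
  have "mset (stack_run st xs) = mset st + mset xs" for st xs :: "'a list"
    by (induction st xs rule: stack_run.induct) auto
  then show ?thesis by (simp add: stack_sort_def)
qed

lemma length_stack_sort [simp]: "length (stack_sort w) = length w"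
  by (rule mset_eq_length[OF mset_stack_sort])

abbreviation stack_sort_iterate :: "'a::linorder list \<Rightarrow> nat \<Rightarrow> 'a list" where
  "stack_sort_iterate w i \<equiv> (stack_sort ^^ i) w"

lemma mset_stack_sort_iterate: "mset (stack_sort_iterate w i) = mset w"
  by (induction i) (simp_all add: mset_stack_sort)

lemma set_stack_sort [simp]: "set (stack_sort w) = set w"
  by (rule mset_eq_setD[OF mset_stack_sort])

lemma distinct_stack_sort [simp]: "distinct (stack_sort w) \<longleftrightarrow> distinct w"
  by (rule mset_eq_imp_distinct_iff[OF mset_stack_sort])

lemma set_stack_sort_iterate [simp]: "set (stack_sort_iterate w i) = set w"
  by (rule mset_eq_setD[OF mset_stack_sort_iterate])

lemma distinct_stack_sort_iterate [simp]: "distinct (stack_sort_iterate w i) \<longleftrightarrow> distinct w"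
  by (rule mset_eq_imp_distinct_iff[OF mset_stack_sort_iterate])

lemma stack_sort_Nil [simp]: "stack_sort [] = []"
  by (simp add: stack_sort_def)

lemma stack_sort_append_max:
  assumes "\<And>x. x \<in> set us \<Longrightarrow> x < m" "\<And>x. x \<in> set vs \<Longrightarrow> x < m"
  shows "stack_sort (us @ m # vs) = stack_sort us @ stack_sort vs @ [m]"
proof -
  have flush: "stack_run st (xs @ m # ys) = stack_run st xs @ stack_run [m] ys"
    if "\<forall>x \<in> set (st @ xs). x < m" for st xs ys
    using that by (induction st xs rule: stack_run.induct) auto
  have bottom: "stack_run (st @ [m]) xs = stack_run st xs @ [m]"
    if "\<forall>x \<in> set xs. x < m" for st xs
    using that by (induction st xs rule: stack_run.induct) auto
  show ?thesis
    unfolding stack_sort_def using flush[of "[]" us] bottom[of vs "[]"] assms by simp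
qed

lemma max_decomposition:
  fixes w :: "'a::linorder list"
  assumes "distinct w" "w \<noteq> []"
  obtains us m vs where "w = us @ m # vs" "\<And>x. x \<in> set (us @ vs) \<Longrightarrow> x < m"
proof -
  have "Max (set w) \<in> set w" using assms(2) by simp
  then obtain us vs where w: "w = us @ Max (set w) # vs" by (meson split_list)
  then have "distinct (us @ Max (set w) # vs)" using assms(1) by simp
  have "x < Max (set w)" if x: "x \<in> set (us @ vs)" for x
  proof -
    have "x \<in> set (us @ Max (set w) # vs)" using x by auto
    then have "x \<le> Max (set w)" using w by simp
    moreover have "x \<noteq> Max (set w)" using x \<open>distinct (us @ Max (set w) # vs)\<close> by auto
    ultimately show ?thesis by simp
  qed
  with w show ?thesis by (rule that)
qed

lemma max_decomposition_induct [consumes 1, case_names Nil max]: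
  fixes w :: "'a::linorder list"
  assumes "distinct w" and "P []"
    and step: "\<And>us m vs. distinct (us @ m # vs) \<Longrightarrow> (\<And>x. x \<in> set (us @ vs) \<Longrightarrow> x < m) \<Longrightarrow>
      P us \<Longrightarrow> P vs \<Longrightarrow> P (us @ m # vs)"
  shows "P w"
  using assms(1)
proof (induction w rule: measure_induct_rule[of length])
  case (less w)
  show ?case
  proof (cases "w = []")
    case False
    with less.prems obtain us m vs where w: "w = us @ m # vs" "\<And>x. x \<in> set (us @ vs) \<Longrightarrow> x < m"
      using max_decomposition by metis
    then have "P us" "P vs" using less by auto
    then show ?thesis unfolding w(1) using w less.prems by (intro step) auto
  qed (simp add: assms(2))
qed

lemma precedes_stack_sort:
  assumes "distinct w" "a < b"
  shows "precedes (stack_sort w) b a \<longleftrightarrow> (\<exists>c>b. precedes w b c \<and> precedes w c a)"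
  using assms(1)
proof (induction w rule: max_decomposition_induct)
  case (max us m vs)
  have sort: "stack_sort (us @ m # vs) = stack_sort us @ stack_sort vs @ [m]"
    using max.hyps by (intro stack_sort_append_max) auto
  show ?case
  proof (cases "b \<in> set us \<and> a \<in> set vs")
    case True
    then show ?thesis using max.hyps unfolding sort by (auto simp: precedes_append)
  next
    case False
    have not_below: "\<not> m < x" if "x \<in> set us \<union> set vs" for x
      using that max.hyps(2)[of x] by auto
    have "precedes (stack_sort (us @ m # vs)) b a \<longleftrightarrow>
        precedes (stack_sort us) b a \<or> precedes (stack_sort vs) b a"
      using False max.hyps(1) not_below assms(2) unfolding sort
      by (auto simp: precedes_append dest: precedes_in_set)
    moreover have "precedes (us @ m # vs) b c \<and> precedes (us @ m # vs) c a \<longleftrightarrow>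
        precedes us b c \<and> precedes us c a \<or> precedes vs b c \<and> precedes vs c a" if "b < c" for c
      using False max.hyps(1) not_below that assms(2)
      by (auto simp: precedes_append dest: precedes_in_set)
    ultimately show ?thesis using max.IH by auto
  qed
qed simp

lemma stack_sort_removeAll:
  assumes "distinct w" "\<And>x y. x \<in> set w \<Longrightarrow> y \<in> set w \<Longrightarrow> x < z \<Longrightarrow> y < z \<Longrightarrow> x = y"
  shows "stack_sort (removeAll z w) = removeAll z (stack_sort w)"
  using assms
proof (induction w rule: max_decomposition_induct)
  case (max us m vs)
  have sort: "stack_sort (us @ m # vs) = stack_sort us @ stack_sort vs @ [m]"
    using max.hyps by (intro stack_sort_append_max) auto
  show ?case
  proof (cases "z = m")
    case True
    have "us = [] \<or> vs = []"
    proof (rule ccontr)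
      assume "\<not> ?thesis"
      then have "hd us \<in> set us" "hd vs \<in> set vs" by simp_all
      moreover from this have "hd us = hd vs"
        using max.hyps(2) True by (intro max.prems) auto
      ultimately show False using max.hyps(1) by auto
    qed
    then show ?thesis using max.hyps unfolding sort by (auto simp: True)
  next
    case False
    have "stack_sort (removeAll z us @ m # removeAll z vs) =
        stack_sort (removeAll z us) @ stack_sort (removeAll z vs) @ [m]"
      using max.hyps by (intro stack_sort_append_max) auto
    then show ?thesis using max False unfolding sort by simp
  qed
qed simp

lemma stack_sort_iterate_removeAll:
  assumes "distinct w" "\<And>x y. x \<in> set w \<Longrightarrow> y \<in> set w \<Longrightarrow> x < z \<Longrightarrow> y < z \<Longrightarrow> x = y"
  shows "stack_sort_iterate (removeAll z w) i = removeAll z (stack_sort_iterate w i)"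
proof (induction i)
  case (Suc i)
  have "stack_sort (removeAll z (stack_sort_iterate w i)) =
      removeAll z (stack_sort (stack_sort_iterate w i))"
    by (rule stack_sort_removeAll) (use assms in auto)
  then show ?case by (simp add: Suc.IH)
qed simp

lemma stack_sort_eventually_sorted:
  "distinct w \<Longrightarrow> \<exists>k. sorted_wrt (<) (stack_sort_iterate w k)"
proof (induction w rule: measure_induct_rule[of length])
  case (less w)
  show ?case
  proof (cases "w = []")
    case True
    then show ?thesis by (intro exI[of _ 0]) simp
  next
    case False
    with less.prems obtain us m vs where w: "w = us @ m # vs" "\<And>x. x \<in> set (us @ vs) \<Longrightarrow> x < m"
      using max_decomposition by metis
    define u where "u = stack_sort us @ stack_sort vs"
    have below: "\<forall>x \<in> set (stack_sort_iterate u k). x < m" for k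
      using w(2) by (auto simp: u_def)
    have "stack_sort_iterate (u @ [m]) k = stack_sort_iterate u k @ [m]" for k
    proof (induction k)
      case (Suc k)
      then show ?case
        using stack_sort_append_max[of "stack_sort_iterate u k" m "[]"] below by simp
    qed simp
    moreover have "stack_sort w = u @ [m]"
      using stack_sort_append_max[of us m vs] w by (simp add: u_def)
    moreover have "length u < length w" "distinct u"
      using less.prems w(1) by (auto simp: u_def)
    then obtain k where "sorted_wrt (<) (stack_sort_iterate u k)" using less.IH by blast
    ultimately have "sorted_wrt (<) (stack_sort_iterate w (Suc k))"
      using below by (simp add: funpow_swap1 sorted_wrt_append)
    then show ?thesis by blast
  qed
qed

section \<open>Champions and their blocks\<close>

definition active :: "nat list \<Rightarrow> nat set" where
  "active w = {x. precedes w x 0}"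

definition champion_set :: "nat list \<Rightarrow> nat set" where
  "champion_set w = {x \<in> active w. \<forall>y \<in> active w. precedes w x y \<longrightarrow> y < x}"

text \<open>The blocks of a word are the fibres of \<open>champion_of\<close> without the champions themselves.\<close>

definition champion_of :: "nat list \<Rightarrow> nat \<Rightarrow> nat" where
  "champion_of w x = Max {y \<in> active w. y = x \<or> precedes w x y}"

definition champion_rank :: "nat list \<Rightarrow> nat \<Rightarrow> nat" where
  "champion_rank w c = card {d \<in> champion_set w. c \<le> d}"

locale distinct_word =
  fixes w :: "nat list"
  assumes distinct: "distinct w"
begin

lemmas precedence_trans = precedes_trans[OF distinct]

lemmas precedence_irrefl = precedes_irrefl[OF distinct]

lemma precedence_asym: "precedes w x y \<Longrightarrow> \<not> precedes w y x"
  using precedence_trans precedence_irrefl by blast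

lemma active_subset: "active w \<subseteq> set w"
  unfolding active_def using precedes_in_set by fast

lemma zero_not_active: "0 \<notin> active w"
  unfolding active_def using precedence_irrefl by simp

lemma finite_active [simp]: "finite (active w)"
  by (rule finite_subset[OF active_subset]) simp

lemma precedence_total_active:
  "x \<in> active w \<Longrightarrow> y \<in> active w \<Longrightarrow> x \<noteq> y \<Longrightarrow> precedes w x y \<or> precedes w y x"
  by (rule precedes_total) (use active_subset in auto)

lemma active_if_precedes_active: "precedes w x y \<Longrightarrow> y \<in> active w \<Longrightarrow> x \<in> active w"
  unfolding active_def using precedence_trans by blast

lemma active_if_champion: "c \<in> champion_set w \<Longrightarrow> c \<in> active w"
  by (simp add: champion_set_def)

lemma finite_champion_set [simp]: "finite (champion_set w)"
  by (simp add: champion_set_def)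

lemma
  assumes "x \<in> active w"
  shows champion_of_active: "champion_of w x \<in> active w"
    and champion_of_eq_or_precedes: "champion_of w x = x \<or> precedes w x (champion_of w x)"
proof -
  have "champion_of w x \<in> {y \<in> active w. y = x \<or> precedes w x y}"
    unfolding champion_of_def using assms by (intro Max_in) auto
  then show "champion_of w x \<in> active w" "champion_of w x = x \<or> precedes w x (champion_of w x)"
    by auto
qed

lemma le_champion_of: "y \<in> active w \<Longrightarrow> y = x \<or> precedes w x y \<Longrightarrow> y \<le> champion_of w x"
  unfolding champion_of_def by (intro Max_ge) auto

lemma champion_of_champion:
  assumes "x \<in> active w"
  shows "champion_of w x \<in> champion_set w"
proof -
  have "y < champion_of w x" if y: "y \<in> active w" "precedes w (champion_of w x) y" for y
  proof -
    have "precedes w x y"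
      using champion_of_eq_or_precedes[OF assms] y(2) precedence_trans by metis
    then have "y \<le> champion_of w x" using le_champion_of y(1) by blast
    moreover have "y \<noteq> champion_of w x" using y(2) precedence_irrefl by metis
    ultimately show ?thesis by simp
  qed
  then show ?thesis using champion_of_active[OF assms] by (simp add: champion_set_def)
qed

lemma le_champion_of_iff:
  assumes "c \<in> champion_set w" "x \<in> active w"
  shows "c \<le> champion_of w x \<longleftrightarrow> x = c \<or> precedes w x c"
proof
  assume le: "c \<le> champion_of w x"
  show "x = c \<or> precedes w x c"
  proof (rule ccontr)
    assume "\<not> ?thesis"
    then have "precedes w c x"
      using assms active_if_champion precedence_total_active by blast
    then have "precedes w c (champion_of w x)"
      using champion_of_eq_or_precedes[OF assms(2)] precedence_trans by metis
    then have "champion_of w x < c"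
      using assms champion_of_active by (simp add: champion_set_def)
    then show False using le by simp
  qed
qed (use assms active_if_champion le_champion_of in blast)

lemma champion_of_antimono:
  assumes "precedes w x y" "y \<in> active w"
  shows "champion_of w y \<le> champion_of w x"
proof -
  have "precedes w x (champion_of w y)"
    using assms champion_of_eq_or_precedes precedence_trans by metis
  then show ?thesis using assms(2) champion_of_active le_champion_of by blast
qed

lemma champion_of_self: "c \<in> champion_set w \<Longrightarrow> champion_of w c = c"
  using champion_of_eq_or_precedes[of c] champion_of_active[of c] le_champion_of[of c c]
  unfolding champion_set_def by fastforce

lemma champion_of_idem: "x \<in> active w \<Longrightarrow> champion_of w (champion_of w x) = champion_of w x"
  by (intro champion_of_self champion_of_champion)

lemma champion_iff: "x \<in> active w \<Longrightarrow> x \<in> champion_set w \<longleftrightarrow> champion_of w x = x"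
  using champion_of_self champion_of_champion by metis

lemma champion_rank_le_iff:
  assumes "c \<in> champion_set w" "d \<in> champion_set w"
  shows "champion_rank w c \<le> champion_rank w d \<longleftrightarrow> d \<le> c"
proof
  assume "champion_rank w c \<le> champion_rank w d"
  show "d \<le> c"
  proof (rule ccontr)
    assume "\<not> d \<le> c"
    then have "{e \<in> champion_set w. d \<le> e} \<subset> {e \<in> champion_set w. c \<le> e}"
      using assms(1) by fastforce
    then have "champion_rank w d < champion_rank w c"
      unfolding champion_rank_def by (intro psubset_card_mono) auto
    then show False using \<open>champion_rank w c \<le> champion_rank w d\<close> by simp
  qed
qed (auto simp: champion_rank_def intro: card_mono)

lemma
  assumes "z \<noteq> 0" "\<And>x. x \<in> active w \<Longrightarrow> z \<le> x"
  shows active_removeAll_least: "active (removeAll z w) = active w - {z}"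
    and champion_of_removeAll_least:
      "x \<in> active w \<Longrightarrow> x \<noteq> z \<Longrightarrow> champion_of (removeAll z w) x = champion_of w x"
    and champion_set_removeAll_least: "champion_set (removeAll z w) = champion_set w - {z}"
proof -
  interpret removed: distinct_word "removeAll z w"
    by unfold_locales (simp add: distinct distinct_removeAll)
  show active: "active (removeAll z w) = active w - {z}"
    using assms(1) by (auto simp: active_def precedes_removeAll)
  show "champion_set (removeAll z w) = champion_set w - {z}"
    unfolding champion_set_def active using assms(2) by (force simp: precedes_removeAll)
  show "champion_of (removeAll z w) x = champion_of w x" if x: "x \<in> active w" "x \<noteq> z"
  proof (rule antisym)
    have x': "x \<in> active (removeAll z w)" using x active by simp
    show "champion_of (removeAll z w) x \<le> champion_of w x"
      using removed.champion_of_eq_or_precedes[OF x'] removed.champion_of_active[OF x'] active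
      by (intro le_champion_of) (auto simp: precedes_removeAll)
    have "x \<le> champion_of w x" using x(1) by (intro le_champion_of) auto
    then have "champion_of w x \<noteq> z" using assms(2)[OF x(1)] x(2) by simp
    then show "champion_of w x \<le> champion_of (removeAll z w) x"
      using champion_of_eq_or_precedes[OF x(1)] champion_of_active[OF x(1)] x(2) active
      by (intro removed.le_champion_of) (auto simp: precedes_removeAll)
  qed
qed

end

section \<open>Blocks after one sorting step\<close>

context distinct_word
begin

interpretation sorted: distinct_word "stack_sort w"
  by unfold_locales (simp add: distinct)

lemma precedes_stack_sort_ascending:
  assumes "x < y" "precedes w x y"
  shows "precedes (stack_sort w) x y"
proof -
  have "\<not> precedes (stack_sort w) y x"
    using assms precedes_stack_sort[OF distinct] precedence_trans precedence_asym by blast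
  then show ?thesis
    using assms precedes_total[of x "stack_sort w" y] precedes_in_set by fastforce
qed

lemma active_stack_sort: "active (stack_sort w) = active w - champion_set w"
proof (intro set_eqI)
  fix x
  have "x \<in> active (stack_sort w) \<longleftrightarrow> x \<noteq> 0 \<and> (\<exists>c>x. precedes w x c \<and> c \<in> active w)"
    using precedes_stack_sort[OF distinct, of 0 x] sorted.precedence_irrefl[of 0]
    by (cases "x = 0") (auto simp: active_def)
  also have "\<dots> \<longleftrightarrow> x \<in> active w - champion_set w"
  proof -
    have "c < x \<longleftrightarrow> \<not> x < c" if "precedes w x c" for c
      using that precedence_irrefl[of x] by (cases c x rule: linorder_cases) auto
    then have "x \<in> champion_set w \<longleftrightarrow> \<not> (\<exists>c>x. precedes w x c \<and> c \<in> active w)"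
      if "x \<in> active w"
      unfolding champion_set_def using that by blast
    moreover have "x \<in> active w" if "precedes w x c" "c \<in> active w" for c
      by (rule active_if_precedes_active[OF that])
    moreover have "x \<noteq> 0" if "x \<in> active w" using that zero_not_active by metis
    ultimately show ?thesis by blast
  qed
  finally show "x \<in> active (stack_sort w) \<longleftrightarrow> x \<in> active w - champion_set w" .
qed

lemma champion_of_greater_if_stack_sort_active:
  assumes "x \<in> active (stack_sort w)"
  shows "x < champion_of w x" and "precedes w x (champion_of w x)"
proof -
  have x: "x \<in> active w" "champion_of w x \<noteq> x"
    using assms champion_iff by (auto simp: active_stack_sort)
  then show "precedes w x (champion_of w x)" using champion_of_eq_or_precedes by blast
  show "x < champion_of w x" using x le_champion_of[of x x] by simp
qed

lemma champion_precedes_in_stack_sort_iff: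
  assumes c: "c \<in> champion_set (stack_sort w)" and x: "x \<in> active (stack_sort w)"
  shows "precedes (stack_sort w) c x \<longleftrightarrow> champion_of w x < champion_of w c"
proof -
  have active: "c \<in> active w" "x \<in> active w" "c \<in> active (stack_sort w)"
    using c x sorted.active_if_champion by (auto simp: active_stack_sort)
  show ?thesis
  proof
    assume cx: "precedes (stack_sort w) c x"
    then have "x < c" using c x by (simp add: champion_set_def)
    then obtain d where d: "c < d" "precedes w c d" "precedes w d x"
      using cx precedes_stack_sort[OF distinct] by blast
    have "d \<in> active w" using d(3) active(2) by (rule active_if_precedes_active)
    moreover have "d \<notin> active (stack_sort w)"
      using c d precedes_stack_sort_ascending[OF d(1,2)] by (fastforce simp: champion_set_def)
    ultimately have "d \<in> champion_set w" by (simp add: active_stack_sort)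
    then have "\<not> d \<le> champion_of w x" "d \<le> champion_of w c"
      using d active le_champion_of_iff precedence_asym precedence_irrefl by blast+
    then show "champion_of w x < champion_of w c" by simp
  next
    assume less: "champion_of w x < champion_of w c"
    then have "c \<noteq> x" by auto
    have "precedes w (champion_of w c) x"
      using less champion_of_champion[OF active(1)] le_champion_of_iff active
        precedence_total_active active_if_champion by (metis leD)
    with \<open>c \<noteq> x\<close> show "precedes (stack_sort w) c x"
      using champion_of_greater_if_stack_sort_active[OF active(3)] precedes_stack_sort[OF distinct]
        precedes_stack_sort_ascending precedence_trans by (metis linorder_neqE_nat)
  qed
qed

text \<open>Sorting keeps the left-to-right order of the blocks.\<close>

lemma le_champion_of_stack_sort_iff:
  assumes "c \<in> champion_set (stack_sort w)" "x \<in> active (stack_sort w)"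
  shows "c \<le> champion_of (stack_sort w) x \<longleftrightarrow> champion_of w c \<le> champion_of w x"
proof -
  have "c \<le> champion_of (stack_sort w) x \<longleftrightarrow> \<not> precedes (stack_sort w) c x"
    using sorted.le_champion_of_iff[OF assms] sorted.precedence_total_active[of c x]
      sorted.precedence_asym sorted.active_if_champion assms by blast
  then show ?thesis using champion_precedes_in_stack_sort_iff[OF assms] by (simp add: not_less)
qed

lemma stack_sort_champion_eq_Max_block:
  assumes c: "c \<in> champion_set (stack_sort w)"
  shows "c = Max {x \<in> active w. champion_of w x = champion_of w c \<and> x \<noteq> champion_of w c}"
proof (rule Max_eqI[symmetric])
  have active: "c \<in> active (stack_sort w)" "c \<in> active w"
    using c sorted.active_if_champion by (auto simp: active_stack_sort)
  then show "c \<in> {x \<in> active w. champion_of w x = champion_of w c \<and> x \<noteq> champion_of w c}"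
    using champion_of_greater_if_stack_sort_active(1) by fastforce
  fix x assume "x \<in> {x \<in> active w. champion_of w x = champion_of w c \<and> x \<noteq> champion_of w c}"
  then have x: "x \<in> active w" "champion_of w x = champion_of w c" "x \<noteq> champion_of w x" by auto
  then have x': "x \<in> active (stack_sort w)" using champion_iff by (auto simp: active_stack_sort)
  let ?d = "champion_of (stack_sort w) x"
  have d: "?d \<in> champion_set (stack_sort w)" using x' by (rule sorted.champion_of_champion)
  have "champion_of w ?d \<le> champion_of w c"
    using le_champion_of_stack_sort_iff[OF d x'] x(2) by simp
  then have "?d \<le> champion_of (stack_sort w) c"
    using le_champion_of_stack_sort_iff[OF d active(1)] by simp
  moreover have "x \<le> ?d" using x' by (intro sorted.le_champion_of) auto
  ultimately show "x \<le> c" using sorted.champion_of_self[OF c] by simp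
qed simp

end

section \<open>The rows of the blocks of the iterates\<close>

definition zero_ended_words :: "nat set \<Rightarrow> nat list set" where
  "zero_ended_words A = {\<pi>. distinct \<pi> \<and> set \<pi> = insert 0 A \<and> last \<pi> = 0}"

text \<open>Iterates are counted from 0, so the one with index \<open>i\<close> determines column \<open>Suc i\<close>.\<close>

fun block_row :: "nat list \<Rightarrow> nat \<Rightarrow> nat \<Rightarrow> nat" where
  "block_row \<pi> 0 x = champion_rank \<pi> (champion_of \<pi> x)"
| "block_row \<pi> (Suc i) x = block_row \<pi> i (champion_of (stack_sort_iterate \<pi> (Suc i)) x)"

locale zero_ended =
  fixes A :: "nat set" and \<pi> :: "nat list"
  assumes word: "\<pi> \<in> zero_ended_words A" and zero_notin: "0 \<notin> A"
begin

abbreviation active_at :: "nat \<Rightarrow> nat set" where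
  "active_at i \<equiv> active (stack_sort_iterate \<pi> i)"

abbreviation champions_at :: "nat \<Rightarrow> nat set" where
  "champions_at i \<equiv> champion_set (stack_sort_iterate \<pi> i)"

abbreviation champion_at :: "nat \<Rightarrow> nat \<Rightarrow> nat" where
  "champion_at i x \<equiv> champion_of (stack_sort_iterate \<pi> i) x"

abbreviation row_at :: "nat \<Rightarrow> nat \<Rightarrow> nat" where
  "row_at \<equiv> block_row \<pi>"

lemma word_distinct: "distinct \<pi>"
  and word_set: "set \<pi> = insert 0 A"
  and word_last: "last \<pi> = 0"
  using word by (simp_all add: zero_ended_words_def)

sublocale iterate: distinct_word "stack_sort_iterate \<pi> i" for i
  by unfold_locales (simp add: word_distinct)

lemma active_0: "active \<pi> = A"
proof (intro equalityI subsetI)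
  fix x assume "x \<in> active \<pi>"
  then show "x \<in> A"
    using iterate.active_subset[of 0] iterate.zero_not_active[of 0] word_set by auto
next
  fix x assume "x \<in> A"
  then show "x \<in> active \<pi>"
    using precedes_last[OF word_distinct, of x] word_set word_last zero_notin
    by (auto simp: active_def)
qed

lemma active_Suc: "active_at (Suc i) = active_at i - champions_at i"
  using iterate.active_stack_sort by simp

lemma active_if_active_Suc: "x \<in> active_at (Suc i) \<Longrightarrow> x \<in> active_at i"
  using active_Suc by blast

lemma active_antimono: "i \<le> j \<Longrightarrow> active_at j \<subseteq> active_at i"
  by (induction j rule: dec_induct) (use active_if_active_Suc in blast)+

lemma active_at_subset: "active_at i \<subseteq> A"
  using active_antimono[of 0 i] active_0 by simp

lemma champions_at_unique:
  assumes "x \<in> champions_at i" "x \<in> champions_at j"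
  shows "i = j"
proof -
  have False if "x \<in> champions_at i" "x \<in> champions_at j" "i < j" for i j
    using that active_Suc active_antimono[of "Suc i" j] iterate.active_if_champion by fastforce
  then show ?thesis using assms by (metis linorder_neqE_nat)
qed

lemma champions_at_exhaust:
  assumes "x \<in> A"
  obtains i where "i < sc \<pi>" "x \<in> champions_at i"
proof -
  have "sorted_wrt (<) (stack_sort_iterate \<pi> (sc \<pi>))"
    unfolding sc_def using stack_sort_eventually_sorted[OF word_distinct] by (rule LeastI_ex)
  then have "x \<notin> active_at (sc \<pi>)"
    unfolding active_def sorted_wrt_iff_precedes by fastforce
  moreover have "x \<in> active_at (sc \<pi>)" if "\<forall>i < sc \<pi>. x \<notin> champions_at i"
  proof -
    have "i \<le> sc \<pi> \<Longrightarrow> x \<in> active_at i" for i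
      by (induction i) (use that assms active_0 active_Suc in auto)
    then show ?thesis by simp
  qed
  ultimately show ?thesis using that by blast
qed

lemma block_row_champion: "x \<in> active_at i \<Longrightarrow> row_at i (champion_at i x) = row_at i x"
  using iterate.champion_of_idem[of x i] by (cases i) auto

lemma block_row_Suc_champion: "c \<in> champions_at (Suc i) \<Longrightarrow> row_at (Suc i) c = row_at i c"
  using iterate.champion_of_self[of c "Suc i"] by simp

lemma le_champion_at_Suc_iff:
  assumes "c \<in> champions_at (Suc i)" "x \<in> active_at (Suc i)"
  shows "c \<le> champion_at (Suc i) x \<longleftrightarrow> champion_at i c \<le> champion_at i x"
  using iterate.le_champion_of_stack_sort_iff[of c i x] assms by simp

lemma block_row_le_iff:
  "x \<in> active_at i \<Longrightarrow> y \<in> active_at i \<Longrightarrow>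
    row_at i x \<le> row_at i y \<longleftrightarrow> champion_at i y \<le> champion_at i x"
proof (induction i arbitrary: x y)
  case 0
  then show ?case
    using iterate.champion_rank_le_iff[of _ 0] iterate.champion_of_champion[of _ 0] by simp
next
  case (Suc i)
  let ?c = "champion_at (Suc i) x" and ?d = "champion_at (Suc i) y"
  have champions: "?c \<in> champions_at (Suc i)" "?d \<in> champions_at (Suc i)"
    using Suc.prems iterate.champion_of_champion by blast+
  have active: "?c \<in> active_at (Suc i)" "?d \<in> active_at (Suc i)"
    using Suc.prems iterate.champion_of_active by blast+
  have "row_at (Suc i) x \<le> row_at (Suc i) y \<longleftrightarrow> row_at i ?c \<le> row_at i ?d"
    by simp
  also have "\<dots> \<longleftrightarrow> champion_at i ?d \<le> champion_at i ?c"
    using active active_if_active_Suc by (intro Suc.IH)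
  also have "\<dots> \<longleftrightarrow> ?d \<le> champion_at (Suc i) ?c"
    using le_champion_at_Suc_iff champions active by simp
  also have "champion_at (Suc i) ?c = ?c"
    using champions(1) by (rule iterate.champion_of_self)
  finally show ?case .
qed

lemma block_row_inj:
  assumes "c \<in> champions_at i" "d \<in> champions_at i" "row_at i c = row_at i d"
  shows "c = d"
proof -
  have "champion_at i c = champion_at i d"
    using assms block_row_le_iff iterate.active_if_champion by (metis order_antisym order_refl)
  then show ?thesis using assms iterate.champion_of_self by metis
qed

text \<open>
  An entry that is still active moves on to the first row, from its present row on, that has a
  champion: the rows passed over have just ended.
\<close>

lemma block_row_Suc_le_champion_iff:
  assumes c: "c \<in> champions_at (Suc i)" and x: "x \<in> active_at (Suc i)"
  shows "row_at (Suc i) x \<le> row_at (Suc i) c \<longleftrightarrow> row_at i x \<le> row_at (Suc i) c"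
proof -
  have active: "c \<in> active_at (Suc i)" using c by (rule iterate.active_if_champion)
  have "row_at (Suc i) x \<le> row_at (Suc i) c \<longleftrightarrow> c \<le> champion_at (Suc i) x"
    using block_row_le_iff[OF x active] iterate.champion_of_self[OF c] by simp
  also have "\<dots> \<longleftrightarrow> champion_at i c \<le> champion_at i x"
    using c x by (rule le_champion_at_Suc_iff)
  also have "\<dots> \<longleftrightarrow> row_at i x \<le> row_at i c"
    using block_row_le_iff x active active_if_active_Suc by simp
  finally show ?thesis using block_row_Suc_champion[OF c] by simp
qed

lemma block_row_Suc_ge: "x \<in> active_at (Suc i) \<Longrightarrow> row_at i x \<le> row_at (Suc i) x"
  using block_row_Suc_le_champion_iff iterate.champion_of_champion block_row_champion
  by (metis order_refl)

lemma block_row_mono: "i \<le> j \<Longrightarrow> x \<in> active_at j \<Longrightarrow> row_at i x \<le> row_at j x"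
  by (induction j rule: dec_induct)
    (use block_row_Suc_ge active_if_active_Suc order_trans in blast)+

lemma
  assumes "c \<in> champions_at (Suc i)"
  shows champion_at_champion_Suc: "champion_at i c \<in> champions_at i"
    and block_row_champion_at_champion_Suc: "row_at i (champion_at i c) = row_at (Suc i) c"
proof -
  have "c \<in> active_at i" using assms iterate.active_if_champion active_if_active_Suc by blast
  then show "champion_at i c \<in> champions_at i" "row_at i (champion_at i c) = row_at (Suc i) c"
    using block_row_Suc_champion[OF assms] iterate.champion_of_champion block_row_champion by auto
qed

lemma block_row_le_champion_iff:
  "x \<in> active_at i \<Longrightarrow> c \<in> champions_at i \<Longrightarrow> row_at i x \<le> row_at i c \<longleftrightarrow> row_at 0 x \<le> row_at i c"
proof (induction i arbitrary: c)
  case (Suc i)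
  have "row_at (Suc i) x \<le> row_at (Suc i) c \<longleftrightarrow> row_at i x \<le> row_at (Suc i) c"
    using Suc.prems by (intro block_row_Suc_le_champion_iff)
  also have "\<dots> \<longleftrightarrow> row_at 0 x \<le> row_at (Suc i) c"
    using Suc.IH[of "champion_at i c"] Suc.prems active_if_active_Suc champion_at_champion_Suc
      block_row_champion_at_champion_Suc by metis
  finally show ?case .
qed simp

lemma block_row_eq_if_initial_eq:
  assumes "x \<in> active_at i" "y \<in> active_at i" "row_at 0 x = row_at 0 y"
  shows "row_at i x = row_at i y"
proof (rule antisym)
  have "row_at i u \<le> row_at i v"
    if "u \<in> active_at i" "v \<in> active_at i" "row_at 0 u = row_at 0 v" for u v
    using that block_row_le_champion_iff[of _ i "champion_at i v"] iterate.champion_of_champion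
      block_row_champion by (metis order_refl)
  then show "row_at i x \<le> row_at i y" "row_at i y \<le> row_at i x" using assms by auto
qed

end

section \<open>Columns and rows of a word\<close>

lemma champions_Cons:
  "xs \<noteq> [] \<Longrightarrow> champions xs = Max (set xs) # champions (after (Max (set xs)) xs)"
  by (subst champions.simps) simp

lemma less_Max_if_precedes:
  "distinct xs \<Longrightarrow> precedes xs (Max (set xs)) x \<Longrightarrow> x < Max (set xs)"
  by (metis List.finite_set Max_ge precedes_in_set precedes_irrefl order_le_less)

lemma set_champions:
  "distinct xs \<Longrightarrow> set (champions xs) = {x \<in> set xs. \<forall>y. precedes xs x y \<longrightarrow> y < x}"
proof (induction xs rule: champions.induct[case_names rec])
  case (rec xs)
  show ?case
  proof (cases "xs = []")
    case False
    define m where "m = Max (set xs)"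
    have m: "m \<in> set xs" "\<And>y. y \<in> set xs \<Longrightarrow> y \<le> m"
      unfolding m_def using False by auto
    have IH: "set (champions (after m xs)) =
        {x. precedes xs m x \<and> (\<forall>y. precedes xs x y \<and> precedes xs m x \<longrightarrow> y < x)}"
      using rec.IH[OF False] distinct_after[OF rec.prems] m(1)
      unfolding m_def[symmetric] by (simp add: set_after precedes_after rec.prems)
    have "x = m \<or> precedes xs m x" if "x \<in> set xs" "\<forall>y. precedes xs x y \<longrightarrow> y < x" for x
      using that m precedes_total by (metis not_le)
    then show ?thesis
      unfolding champions_Cons[OF False] m_def[symmetric] list.set IH
      using less_Max_if_precedes[OF rec.prems] m(1) by (auto simp: m_def dest: precedes_in_set)
  qed (simp add: champions.simps)
qed

lemma sorted_champions: "distinct xs \<Longrightarrow> sorted_wrt (>) (champions xs)"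
proof (induction xs rule: champions.induct[case_names rec])
  case (rec xs)
  show ?case
  proof (cases "xs = []")
    case False
    let ?m = "Max (set xs)"
    have after: "set (after ?m xs) = {x. precedes xs ?m x}"
      using rec.prems False by (simp add: set_after)
    have "x < ?m" if "x \<in> set (champions (after ?m xs))" for x
    proof -
      have "precedes xs ?m x"
        using that after by (simp add: set_champions distinct_after rec.prems)
      then show ?thesis
        by (rule less_Max_if_precedes[OF rec.prems])
    qed
    then show ?thesis
      using rec False by (simp add: champions_Cons[OF False] distinct_after)
  qed (simp add: champions.simps)
qed

lemma card_ge_nth_descending:
  fixes xs :: "'a::linorder list"
  shows "sorted_wrt (>) xs \<Longrightarrow> j < length xs \<Longrightarrow> card {x \<in> set xs. xs ! j \<le> x} = Suc j"
proof (induction xs arbitrary: j)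
  case (Cons x xs)
  show ?case
  proof (cases j)
    case 0
    have "{y \<in> set (x # xs). x \<le> y} = {x}" using Cons.prems by fastforce
    then show ?thesis using 0 by simp
  next
    case (Suc k)
    then have "xs ! k < x" using Cons.prems by simp
    then have "{y \<in> set (x # xs). (x # xs) ! j \<le> y} = insert x {y \<in> set xs. xs ! k \<le> y}"
      using Suc by auto
    moreover have "x \<notin> set xs" using Cons.prems by auto
    ultimately show ?thesis using Cons Suc by simp
  qed
qed simp

context zero_ended
begin

abbreviation rank_at :: "nat \<Rightarrow> nat \<Rightarrow> nat" where
  "rank_at i c \<equiv> champion_rank (stack_sort_iterate \<pi> i) c"

lemma set_C_seq: "set (C_seq \<pi> (Suc i)) = champions_at i"
  and sorted_C_seq: "sorted_wrt (>) (C_seq \<pi> (Suc i))"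
proof -
  let ?w = "stack_sort_iterate \<pi> i"
  have zero: "0 \<in> set ?w" by (simp add: word_set)
  have "set (before 0 ?w) = active_at i"
    using set_before[OF iterate.distinct zero] by (simp add: active_def)
  moreover have "precedes (before 0 ?w) x y \<longleftrightarrow> precedes ?w x y \<and> y \<in> active_at i" for x y
    using precedes_before[OF iterate.distinct zero] by (simp add: active_def)
  ultimately show "set (C_seq \<pi> (Suc i)) = champions_at i"
    using set_champions[OF distinct_before[OF iterate.distinct], of 0 i]
    by (auto simp: C_seq_def sigma_def champion_set_def)
  show "sorted_wrt (>) (C_seq \<pi> (Suc i))"
    using sorted_champions[OF distinct_before[OF iterate.distinct]]
    by (simp add: C_seq_def sigma_def)
qed

lemma
  assumes "j \<in> {1..length (C_seq \<pi> (Suc i))}"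
  shows c_entry_champion: "c_entry \<pi> (Suc i) j \<in> champions_at i"
    and rank_at_c_entry: "rank_at i (c_entry \<pi> (Suc i) j) = j"
proof -
  have j: "j - 1 < length (C_seq \<pi> (Suc i))" using assms by auto
  then show "c_entry \<pi> (Suc i) j \<in> champions_at i"
    unfolding c_entry_def set_C_seq[symmetric] by (rule nth_mem)
  show "rank_at i (c_entry \<pi> (Suc i) j) = j"
    using card_ge_nth_descending[OF sorted_C_seq j] assms
    by (simp add: champion_rank_def c_entry_def set_C_seq)
qed

lemma
  assumes "c \<in> champions_at i"
  shows rank_at_bounds: "rank_at i c \<in> {1..length (C_seq \<pi> (Suc i))}"
    and c_entry_rank_at: "c_entry \<pi> (Suc i) (rank_at i c) = c"
proof -
  obtain k where k: "k < length (C_seq \<pi> (Suc i))" "C_seq \<pi> (Suc i) ! k = c"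
    using assms set_C_seq by (metis in_set_conv_nth)
  then have c: "c = c_entry \<pi> (Suc i) (Suc k)" by (simp add: c_entry_def)
  then have "rank_at i c = Suc k" using rank_at_c_entry[of "Suc k" i] k(1) by simp
  then show "rank_at i c \<in> {1..length (C_seq \<pi> (Suc i))}" "c_entry \<pi> (Suc i) (rank_at i c) = c"
    using k(1) c by auto
qed

lemma coords_champion:
  assumes "x \<in> champions_at i"
  shows "coords \<pi> x = (Suc i, rank_at i x)"
  unfolding coords_def
proof (rule the_equality)
  have "x \<in> A" using assms iterate.active_if_champion active_at_subset by blast
  then obtain i' where "i' < sc \<pi>" "x \<in> champions_at i'" by (rule champions_at_exhaust)
  then have "i < sc \<pi>" using assms champions_at_unique by metis
  then show "case (Suc i, rank_at i x) of (i, j) \<Rightarrow>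
      i \<in> {1..sc \<pi>} \<and> j \<in> {1..length (C_seq \<pi> i)} \<and> x = c_entry \<pi> i j"
    using rank_at_bounds[OF assms] c_entry_rank_at[OF assms] by auto
next
  fix p
  assume p: "case p of (i, j) \<Rightarrow>
      i \<in> {1..sc \<pi>} \<and> j \<in> {1..length (C_seq \<pi> i)} \<and> x = c_entry \<pi> i j"
  then obtain i' j where ij: "p = (Suc i', j)" "j \<in> {1..length (C_seq \<pi> (Suc i'))}"
      "x = c_entry \<pi> (Suc i') j"
    by (cases p; cases "fst p") auto
  then have "i' = i" using c_entry_champion champions_at_unique assms by metis
  then show "p = (Suc i, rank_at i x)" using ij rank_at_c_entry by simp
qed

lemma col_champion: "x \<in> champions_at i \<Longrightarrow> col \<pi> x = Suc i"
  by (simp add: col_def coords_champion)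

lemma colpos_champion: "x \<in> champions_at i \<Longrightarrow> colpos \<pi> x = rank_at i x"
  by (simp add: colpos_def coords_champion)

lemma precedes_champion_iff:
  assumes "c \<in> champions_at i"
  shows "precedes (stack_sort_iterate \<pi> i) x c \<longleftrightarrow>
    x \<in> active_at i \<and> x \<noteq> c \<and> rank_at i (champion_at i x) \<le> rank_at i c"
proof -
  have "precedes (stack_sort_iterate \<pi> i) x c \<Longrightarrow> x \<in> active_at i \<and> x \<noteq> c"
    using assms iterate.active_if_precedes_active iterate.active_if_champion
      iterate.precedence_irrefl by blast
  moreover have "rank_at i (champion_at i x) \<le> rank_at i c \<longleftrightarrow> c \<le> champion_at i x"
    if "x \<in> active_at i"
    using that assms iterate.champion_of_champion by (intro iterate.champion_rank_le_iff)
  ultimately show ?thesis using iterate.le_champion_of_iff[OF assms] by metis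
qed

lemma champion_precedes_iff:
  assumes "c \<in> champions_at i" "x \<in> active_at i"
  shows "precedes (stack_sort_iterate \<pi> i) c x \<longleftrightarrow>
    rank_at i c < rank_at i (champion_at i x)"
proof -
  have "precedes (stack_sort_iterate \<pi> i) c x \<longleftrightarrow>
      \<not> (x = c \<or> precedes (stack_sort_iterate \<pi> i) x c)"
    using assms iterate.precedence_total_active iterate.active_if_champion iterate.precedence_asym
      iterate.precedence_irrefl by metis
  also have "\<dots> \<longleftrightarrow> rank_at i c < rank_at i (champion_at i x)"
    using assms precedes_champion_iff iterate.champion_of_self
    by (metis le_less_linear leD order_refl)
  finally show ?thesis .
qed

lemma champion_in_iterate: "c \<in> champions_at i \<Longrightarrow> c \<in> set (stack_sort_iterate \<pi> i)"
  using iterate.active_if_champion iterate.active_subset by blast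

lemma set_first_block:
  assumes "1 \<in> {1..length (C_seq \<pi> (Suc i))}"
  shows "set (block \<pi> (Suc i) 1) =
    {x. precedes (stack_sort_iterate \<pi> i) x (c_entry \<pi> (Suc i) 1)}"
  using set_before[OF iterate.distinct champion_in_iterate[OF c_entry_champion[OF assms]]]
  by (simp add: block_def sigma_def)

lemma set_later_block:
  assumes j: "j \<in> {1..length (C_seq \<pi> (Suc i))}" "j \<noteq> 1"
  shows "set (block \<pi> (Suc i) j) =
    {x. precedes (stack_sort_iterate \<pi> i) x (c_entry \<pi> (Suc i) j) \<and>
      precedes (stack_sort_iterate \<pi> i) (c_entry \<pi> (Suc i) (j - 1)) x}"
proof -
  let ?w = "stack_sort_iterate \<pi> i"
  let ?c = "c_entry \<pi> (Suc i) j" and ?d = "c_entry \<pi> (Suc i) (j - 1)"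
  have j': "j - 1 \<in> {1..length (C_seq \<pi> (Suc i))}" using j by auto
  have c: "?c \<in> champions_at i" "rank_at i ?c = j"
    using j(1) by (rule c_entry_champion rank_at_c_entry)+
  have d: "?d \<in> champions_at i" "rank_at i ?d = j - 1"
    using j' by (rule c_entry_champion rank_at_c_entry)+
  have d_in: "?d \<in> set ?w" using d(1) by (rule champion_in_iterate)
  have "precedes ?w ?d ?c"
    using c d j champion_precedes_iff iterate.active_if_champion iterate.champion_of_self by simp
  then have "?c \<in> set (after ?d ?w)" using set_after[OF iterate.distinct d_in] by simp
  then show ?thesis
    using set_before[OF distinct_after[OF iterate.distinct]]
      precedes_after[OF iterate.distinct d_in] j(2) by (simp add: block_def sigma_def)
qed

lemma set_block:
  assumes j: "j \<in> {1..length (C_seq \<pi> (Suc i))}"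
  shows "set (block \<pi> (Suc i) j) =
    {x \<in> active_at i. champion_at i x = c_entry \<pi> (Suc i) j \<and> x \<noteq> c_entry \<pi> (Suc i) j}"
    (is "_ = ?block")
proof -
  let ?c = "c_entry \<pi> (Suc i) j" and ?d = "c_entry \<pi> (Suc i) (j - 1)"
  have c: "?c \<in> champions_at i" "rank_at i ?c = j"
    using j by (rule c_entry_champion rank_at_c_entry)+
  have "champion_at i x = ?c \<longleftrightarrow> rank_at i (champion_at i x) = j" if "x \<in> active_at i" for x
    using c c_entry_rank_at iterate.champion_of_champion[OF that] by metis
  then have block: "?block = {x \<in> active_at i. rank_at i (champion_at i x) = j \<and> x \<noteq> ?c}"
    by blast
  show ?thesis
  proof (cases "j = 1")
    case True
    have "1 \<le> rank_at i (champion_at i x)" if "x \<in> active_at i" for x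
      using rank_at_bounds[OF iterate.champion_of_champion[OF that]] by simp
    then have "{x. precedes (stack_sort_iterate \<pi> i) x ?c} = ?block"
      unfolding block precedes_champion_iff[OF c(1)] c(2) using True by (auto intro: antisym)
    then show ?thesis using set_first_block j True by simp
  next
    case False
    then have "j - 1 \<in> {1..length (C_seq \<pi> (Suc i))}" using j by auto
    then have d: "?d \<in> champions_at i" "rank_at i ?d = j - 1"
      by (rule c_entry_champion rank_at_c_entry)+
    show ?thesis
      unfolding set_later_block[OF j False] block
      using precedes_champion_iff[OF c(1)] champion_precedes_iff[OF d(1)] c(2) d(2) False j by auto
  qed
qed

lemma leftof_champion:
  assumes x: "x \<in> champions_at (Suc i)"
  shows "leftof \<pi> x = champion_at i x"
proof -
  let ?c = "champion_at i x"
  let ?P = "\<lambda>j. j \<in> {1..length (C_seq \<pi> (Suc i))} \<and>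
    block \<pi> (Suc i) j \<noteq> [] \<and> x = Max (set (block \<pi> (Suc i) j))"
  have c: "?c \<in> champions_at i" using x by (rule champion_at_champion_Suc)
  have "x \<in> active_at i" using x iterate.active_if_champion active_if_active_Suc by blast
  moreover have "x \<noteq> ?c" using x c champions_at_unique[of x i "Suc i"] by auto
  ultimately have x_block: "x \<in> {y \<in> active_at i. champion_at i y = ?c \<and> y \<noteq> ?c}" by simp
  have "(THE j. ?P j) = rank_at i ?c"
  proof (rule the_equality)
    have block: "set (block \<pi> (Suc i) (rank_at i ?c)) =
        {y \<in> active_at i. champion_at i y = ?c \<and> y \<noteq> ?c}"
      using set_block[OF rank_at_bounds[OF c]] c_entry_rank_at[OF c] by simp
    then have "x \<in> set (block \<pi> (Suc i) (rank_at i ?c))" using x_block by blast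
    then have "block \<pi> (Suc i) (rank_at i ?c) \<noteq> []" by auto
    moreover have "x = Max (set (block \<pi> (Suc i) (rank_at i ?c)))"
      unfolding block using iterate.stack_sort_champion_eq_Max_block[of x i] x by simp
    ultimately show "?P (rank_at i ?c)" using rank_at_bounds[OF c] by simp
  next
    fix j assume j: "?P j"
    then have "x \<in> set (block \<pi> (Suc i) j)"
      using Max_in[of "set (block \<pi> (Suc i) j)"] by simp
    then have "?c = c_entry \<pi> (Suc i) j" using set_block j by blast
    then show "j = rank_at i ?c" using rank_at_c_entry j by simp
  qed
  then show ?thesis
    using col_champion[OF x] c_entry_rank_at[OF c] by (simp add: leftof_def)
qed

lemma row_champion: "x \<in> champions_at i \<Longrightarrow> row \<pi> x = row_at i x"
proof (induction i arbitrary: x)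
  case 0
  then have "row \<pi> x = rank_at 0 x"
    by (subst row.simps) (simp add: col_champion[OF 0] colpos_champion[OF 0])
  then show ?case using iterate.champion_of_self[OF 0] by simp
next
  case (Suc i)
  have "row \<pi> x = row \<pi> (champion_at i x)"
    by (subst row.simps) (simp add: col_champion[OF Suc.prems] leftof_champion[OF Suc.prems])
  then show ?case
    using Suc champion_at_champion_Suc block_row_champion_at_champion_Suc by metis
qed

lemma T_of_champion: "x \<in> champions_at i \<Longrightarrow> T_of \<pi> x = (Suc i, row_at i x)"
  by (simp add: T_of_def col_champion row_champion)

lemma champions_at_0_eq: "champions_at 0 = {x \<in> A. fst (T_of \<pi> x) = 1}"
proof (intro equalityI subsetI)
  fix x assume "x \<in> champions_at 0"
  then show "x \<in> {x \<in> A. fst (T_of \<pi> x) = 1}"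
    using T_of_champion iterate.active_if_champion active_at_subset by fastforce
next
  fix x assume x: "x \<in> {x \<in> A. fst (T_of \<pi> x) = 1}"
  then obtain i where "x \<in> champions_at i" using champions_at_exhaust by blast
  then show "x \<in> champions_at 0" using x T_of_champion[of x i] by simp
qed

lemma inj_on_T_of: "inj_on (T_of \<pi>) A"
proof (rule inj_onI)
  fix x y assume "x \<in> A" "y \<in> A" and eq: "T_of \<pi> x = T_of \<pi> y"
  then obtain i j where "x \<in> champions_at i" "y \<in> champions_at j"
    using champions_at_exhaust by metis
  then show "x = y" using eq T_of_champion block_row_inj by auto
qed

lemma T_of_image_iff: "(Suc i, k) \<in> T_of \<pi> ` A \<longleftrightarrow> (\<exists>c \<in> champions_at i. row_at i c = k)"
proof
  assume "(Suc i, k) \<in> T_of \<pi> ` A"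
  then obtain x where x: "x \<in> A" "T_of \<pi> x = (Suc i, k)" by auto
  from x(1) obtain i' where i': "x \<in> champions_at i'" by (rule champions_at_exhaust)
  then show "\<exists>c \<in> champions_at i. row_at i c = k" using T_of_champion[OF i'] x(2) by auto
next
  assume "\<exists>c \<in> champions_at i. row_at i c = k"
  then obtain c where c: "c \<in> champions_at i" "T_of \<pi> c = (Suc i, k)" using T_of_champion by auto
  then have "c \<in> A" using iterate.active_if_champion active_at_subset by blast
  then show "(Suc i, k) \<in> T_of \<pi> ` A" using c(2) by (metis imageI)
qed

lemma card_champions_at_0: "card (champions_at 0) = card {p \<in> T_of \<pi> ` A. fst p = 1}"
proof -
  have "{p \<in> T_of \<pi> ` A. fst p = 1} = T_of \<pi> ` champions_at 0"
    unfolding champions_at_0_eq by auto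
  moreover have "inj_on (T_of \<pi>) (champions_at 0)"
    using inj_on_T_of unfolding champions_at_0_eq by (rule inj_on_subset) auto
  ultimately show ?thesis by (simp add: card_image)
qed

lemma length_C_seq_1: "length (C_seq \<pi> 1) = card {p \<in> T_of \<pi> ` A. fst p = 1}"
proof -
  have "distinct (C_seq \<pi> 1)"
    using sorted_C_seq[of 0] by (auto simp: distinct_conv_nth sorted_wrt_iff_nth_less nat_neq_iff)
  then have "length (C_seq \<pi> 1) = card (champions_at 0)"
    using set_C_seq[of 0] distinct_card by fastforce
  then show ?thesis by (simp only: card_champions_at_0)
qed

end

section \<open>Composition shapes and hooks\<close>

definition composition_shape :: "(nat \<times> nat) set \<Rightarrow> bool" where
  "composition_shape D \<longleftrightarrow> finite D \<and> (\<forall>i j. (i, j) \<in> D \<longrightarrow> 1 \<le> i \<and> 1 \<le> j) \<and>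
     (\<forall>i i' j. (i, j) \<in> D \<longrightarrow> 1 \<le> i' \<longrightarrow> i' \<le> i \<longrightarrow> (i', j) \<in> D) \<and>
     (\<forall>j j'. (1, j) \<in> D \<longrightarrow> 1 \<le> j' \<longrightarrow> j' \<le> j \<longrightarrow> (1, j') \<in> D)"

lemma
  assumes "composition_shape D"
  shows composition_shape_finite: "finite D"
    and composition_shape_pos: "(i, j) \<in> D \<Longrightarrow> 1 \<le> i \<and> 1 \<le> j"
    and composition_shape_left: "(i, j) \<in> D \<Longrightarrow> 1 \<le> i' \<Longrightarrow> i' \<le> i \<Longrightarrow> (i', j) \<in> D"
    and composition_shape_first_column: "(1, j) \<in> D \<Longrightarrow> 1 \<le> j' \<Longrightarrow> j' \<le> j \<Longrightarrow> (1, j') \<in> D"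
  using assms unfolding composition_shape_def by blast+

definition corner :: "(nat \<times> nat) set \<Rightarrow> nat \<times> nat \<Rightarrow> bool" where
  "corner D p \<longleftrightarrow> p \<in> D \<and> (\<forall>q \<in> D. ge_D p q \<longrightarrow> q = p)"

text \<open>
  The least entry of a tableau occupies a corner, so only cells that become corners are addable;
  cells of the first column are left out.
\<close>

definition addable :: "(nat \<times> nat) set \<Rightarrow> nat \<Rightarrow> nat \<Rightarrow> bool" where
  "addable D i j \<longleftrightarrow> 2 \<le> i \<and> (i - 1, j) \<in> D \<and> (\<forall>k \<ge> j. (i, k) \<notin> D)"

definition hook_cells :: "(nat \<times> nat) set \<Rightarrow> nat \<Rightarrow> nat \<Rightarrow> (nat \<times> nat) set" where
  "hook_cells D i j = {(i', j') \<in> D. i' < i \<and> j' \<le> j \<and> (\<forall>k \<in> {j'..<j}. (i - 1, k) \<notin> D)}"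

definition hook_number :: "(nat \<times> nat) set \<Rightarrow> nat \<Rightarrow> nat \<Rightarrow> nat" where
  "hook_number D i j = (if i = 1 then 1 else card (hook_cells D i j))"

lemma corner_maximal: "corner D (i, j) \<Longrightarrow> (i', j') \<in> D \<Longrightarrow> i \<le> i' \<Longrightarrow> j \<le> j' \<Longrightarrow> (i', j') = (i, j)"
  by (auto simp: corner_def ge_D_def)

lemma composition_shape_remove_corner:
  assumes "composition_shape D" "corner D p"
  shows "composition_shape (D - {p})"
proof -
  obtain a b where p: "p = (a, b)" by fastforce
  have below: "q \<noteq> p" if "(i, j) \<in> D - {p}" "q = (i', j')" "i' \<le> i" "j' \<le> j" for q i j i' j'
    using corner_maximal[of D a b i j] assms(2) that p by auto
  show ?thesis
    unfolding composition_shape_def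
  proof (intro conjI allI impI)
    show "finite (D - {p})" using composition_shape_finite[OF assms(1)] by simp
  next
    fix i j assume ij: "(i, j) \<in> D - {p}"
    then show "1 \<le> i" "1 \<le> j" using composition_shape_pos[OF assms(1), of i j] by auto
    fix i' assume "1 \<le> i'" "i' \<le> i"
    then show "(i', j) \<in> D - {p}"
      using ij below[OF ij refl, of i' j] composition_shape_left[OF assms(1), of i j i'] by auto
  next
    fix j j' assume j: "(1, j) \<in> D - {p}" "1 \<le> j'" "j' \<le> j"
    then show "(1, j') \<in> D - {p}"
      using below[OF j(1) refl, of 1 j'] composition_shape_first_column[OF assms(1), of j j']
      by auto
  qed
qed

lemma hook_cells_remove_corner:
  assumes "corner D p" "(i, j) \<in> D"
  shows "hook_cells (D - {p}) i j = hook_cells D i j"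
proof -
  obtain a b where p: "p = (a, b)" by fastforce
  have outside: "\<not> (a \<le> i \<and> b \<le> j \<and> (a < i \<or> b < j))"
    using corner_maximal[of D a b i j] assms p by auto
  then have "(i - 1, k) \<in> D - {p} \<longleftrightarrow> (i - 1, k) \<in> D" if "k < j" for k
    using that p by auto
  then have "(\<forall>k \<in> {j'..<j}. (i - 1, k) \<notin> D - {p}) \<longleftrightarrow> (\<forall>k \<in> {j'..<j}. (i - 1, k) \<notin> D)" for j'
    by simp
  then show ?thesis unfolding hook_cells_def using outside p by auto
qed

lemma hook_number_remove_corner:
  "corner D p \<Longrightarrow> (i, j) \<in> D \<Longrightarrow> hook_number (D - {p}) i j = hook_number D i j"
  by (simp add: hook_number_def hook_cells_remove_corner)

lemma addable_remove_corner:
  assumes "composition_shape D" "corner D (i, j)" "i \<noteq> 1"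
  shows "addable (D - {(i, j)}) i j"
proof -
  have ij: "(i, j) \<in> D" using assms(2) by (simp add: corner_def)
  then have "2 \<le> i" using composition_shape_pos[OF assms(1) ij] assms(3) by simp
  then show ?thesis
    using composition_shape_left[OF assms(1) ij, of "i - 1"] corner_maximal[OF assms(2)]
    by (fastforce simp: addable_def)
qed

lemma first_column_remove_corner:
  assumes "composition_shape D" "corner D (1, j)"
  shows "{p \<in> D - {(1, j)}. fst p = 1} = Pair 1 ` {1..<j}"
proof (intro equalityI subsetI)
  fix p assume p: "p \<in> {p \<in> D - {(1, j)}. fst p = 1}"
  then obtain k where k: "p = (1, k)" "(1, k) \<in> D" "k \<noteq> j" by (cases p) auto
  then have "k < j" using corner_maximal[OF assms(2), of 1 k] by fastforce
  then show "p \<in> Pair 1 ` {1..<j}" using k composition_shape_pos[OF assms(1)] by auto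
next
  fix p :: "nat \<times> nat" assume "p \<in> Pair 1 ` {1..<j}"
  then show "p \<in> {p \<in> D - {(1, j)}. fst p = 1}"
    using composition_shape_first_column[OF assms(1)] assms(2) by (auto simp: corner_def)
qed

lemma addable_hooks_disjoint:
  assumes D: "composition_shape D"
    and addable: "addable D i j" "addable D i' j'"
    and hooks: "p \<in> hook_cells D i j" "p \<in> hook_cells D i' j'"
  shows "(i, j) = (i', j')"
proof -
  have not_less: "\<not> b < b'"
    if "addable D a b" "addable D a' b'" "p \<in> hook_cells D a b" "p \<in> hook_cells D a' b'"
    for a b a' b'
  proof
    assume "b < b'"
    then have "(a' - 1, b) \<notin> D" using that(3,4) by (auto simp: hook_cells_def)
    then have "a \<le> a' - 1"
      using that(1,2) composition_shape_left[OF D, of "a - 1" b "a' - 1"]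
      by (force simp: addable_def)
    then have "(a, b') \<in> D"
      using that(1,2) composition_shape_left[OF D, of "a' - 1" b' a] by (simp add: addable_def)
    then show False using that(1) \<open>b < b'\<close> by (simp add: addable_def)
  qed
  have "j = j'" using not_less addable hooks by (metis linorder_neqE_nat)
  moreover have "a' \<le> a" if "addable D a j" "addable D a' j" for a a'
    using that composition_shape_left[OF D, of "a' - 1" j a] by (force simp: addable_def)
  then have "i = i'" using addable \<open>j = j'\<close> by (metis order_antisym)
  ultimately show ?thesis by simp
qed

section \<open>Inserting a new least positive entry\<close>

definition insert_before :: "'a \<Rightarrow> 'a \<Rightarrow> 'a list \<Rightarrow> 'a list" where
  "insert_before z y w = before y w @ z # y # after y w"

lemma insert_before_split:
  assumes "y \<in> set w"
  obtains us vs where "y \<notin> set us" "w = us @ y # vs" "insert_before z y w = us @ z # y # vs"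
  using before_append_after[OF assms] pivot_notin_before unfolding insert_before_def by metis

lemma set_insert_before: "y \<in> set w \<Longrightarrow> set (insert_before z y w) = insert z (set w)"
  by (erule insert_before_split[where z = z]) auto

lemma distinct_insert_before:
  "y \<in> set w \<Longrightarrow> distinct (insert_before z y w) \<longleftrightarrow> distinct w \<and> z \<notin> set w"
  by (erule insert_before_split[where z = z]) auto

lemma last_insert_before: "y \<in> set w \<Longrightarrow> last (insert_before z y w) = last w"
  by (erule insert_before_split[where z = z]) auto

lemma removeAll_insert_before:
  "y \<in> set w \<Longrightarrow> z \<notin> set w \<Longrightarrow> removeAll z (insert_before z y w) = w"
  by (erule insert_before_split[where z = z]) auto

lemma after_insert_before:
  "y \<in> set w \<Longrightarrow> z \<notin> set w \<Longrightarrow> after z (insert_before z y w) = y # after y w"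
  by (erule insert_before_split[where z = z]) auto

lemma precedes_insert_before_iff:
  assumes "distinct w" "y \<in> set w" "z \<notin> set w"
  shows "precedes (insert_before z y w) z x \<longleftrightarrow> x = y \<or> precedes w y x"
proof -
  have "distinct (insert_before z y w)" using assms by (simp add: distinct_insert_before)
  then have "precedes (insert_before z y w) z x \<longleftrightarrow> x \<in> set (y # after y w)"
    unfolding insert_before_def by (rule precedes_pivot_iff(2))
  then show ?thesis using assms by (auto simp: set_after)
qed

lemma insert_before_zero_ended_words:
  assumes "w \<in> zero_ended_words A" "y \<in> insert 0 A" "z \<noteq> 0" "z \<notin> A"
  shows "insert_before z y w \<in> zero_ended_words (insert z A)"
  using assms unfolding zero_ended_words_def
  by (auto simp: set_insert_before distinct_insert_before last_insert_before)

lemma insert_before_removeAll: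
  assumes "z \<noteq> 0" "z \<notin> A" and u: "u \<in> zero_ended_words (insert z A)"
  shows "removeAll z u \<in> zero_ended_words A" and "hd (after z u) \<in> insert 0 A"
    and "insert_before z (hd (after z u)) (removeAll z u) = u"
proof -
  have "z \<in> set u" using u by (simp add: zero_ended_words_def)
  then obtain us vs' where "u = us @ z # vs'" by (meson split_list)
  moreover from this have "vs' \<noteq> []" using u assms(1) by (auto simp: zero_ended_words_def)
  ultimately obtain y vs where split: "u = us @ z # y # vs" by (cases vs') auto
  then have distinct: "distinct (us @ z # y # vs)"
    and set: "set (us @ z # y # vs) = insert 0 (insert z A)"
    and last: "last (us @ y # vs) = 0"
    using u by (auto simp: zero_ended_words_def)
  have "set (us @ y # vs) = set (us @ z # y # vs) - {z}" using distinct by auto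
  then have "set (us @ y # vs) = insert 0 A" unfolding set using assms(1,2) by auto
  moreover from this have "y \<in> insert 0 A" by auto
  moreover have "removeAll z u = us @ y # vs" "after z u = y # vs"
    using distinct by (auto simp: split)
  ultimately show "removeAll z u \<in> zero_ended_words A" "hd (after z u) \<in> insert 0 A"
    "insert_before z (hd (after z u)) (removeAll z u) = u"
    using distinct last by (auto simp: split zero_ended_words_def insert_before_def)
qed

lemma bij_betw_insert_before:
  assumes "z \<noteq> 0" "z \<notin> A"
  shows "bij_betw (\<lambda>(w, y). insert_before z y w)
    (zero_ended_words A \<times> insert 0 A) (zero_ended_words (insert z A))"
proof (rule bij_betwI[where g = "\<lambda>u. (removeAll z u, hd (after z u))"])
  show "(\<lambda>(w, y). insert_before z y w) \<in>
      zero_ended_words A \<times> insert 0 A \<rightarrow> zero_ended_words (insert z A)"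
    using assms by (auto intro: insert_before_zero_ended_words)
  show "(\<lambda>u. (removeAll z u, hd (after z u))) \<in>
      zero_ended_words (insert z A) \<rightarrow> zero_ended_words A \<times> insert 0 A"
    using insert_before_removeAll[OF assms] by blast
  show "(removeAll z (case p of (w, y) \<Rightarrow> insert_before z y w),
      hd (after z (case p of (w, y) \<Rightarrow> insert_before z y w))) = p"
    if "p \<in> zero_ended_words A \<times> insert 0 A" for p
    using that assms
    by (auto simp: zero_ended_words_def removeAll_insert_before after_insert_before)
  show "(case (removeAll z u, hd (after z u)) of (w, y) \<Rightarrow> insert_before z y w) = u"
    if "u \<in> zero_ended_words (insert z A)" for u
    using insert_before_removeAll(3)[OF assms that] by simp
qed

locale min_insertion = small: zero_ended A w for A w +
  fixes z y :: nat
  assumes y_in: "y \<in> insert 0 A" and z_pos: "z \<noteq> 0" and z_less: "x \<in> A \<Longrightarrow> z < x"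
begin

abbreviation inserted :: "nat list" where
  "inserted \<equiv> insert_before z y w"

lemma z_notin: "z \<notin> A"
  using z_less by blast

lemma y_in_word: "y \<in> set w" and z_notin_word: "z \<notin> set w"
  using y_in z_pos z_notin by (simp_all add: small.word_set)

sublocale big: zero_ended "insert z A" inserted
  using insert_before_zero_ended_words[OF small.word y_in z_pos z_notin] small.zero_notin z_pos
  by unfold_locales auto

lemma iterate_eq_removeAll: "stack_sort_iterate w i = removeAll z (stack_sort_iterate inserted i)"
proof -
  have "stack_sort_iterate (removeAll z inserted) i = removeAll z (stack_sort_iterate inserted i)"
    using z_less big.word_set
    by (intro stack_sort_iterate_removeAll big.word_distinct) (auto dest: less_asym)
  then show ?thesis by (simp add: removeAll_insert_before y_in_word z_notin_word)
qed

lemma z_le_active: "x \<in> big.active_at i \<Longrightarrow> z \<le> x"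
  using big.active_at_subset z_less by fastforce

lemma champion_at_eq: "x \<in> small.active_at i \<Longrightarrow> big.champion_at i x = small.champion_at i x"
  and champions_at_eq: "small.champions_at i = big.champions_at i - {z}"
  unfolding iterate_eq_removeAll
  using big.iterate.active_removeAll_least big.iterate.champion_of_removeAll_least
    big.iterate.champion_set_removeAll_least z_pos z_le_active by simp_all

lemma row_at_eq: "x \<in> small.active_at i \<Longrightarrow> big.row_at i x = small.row_at i x"
proof (induction i arbitrary: x)
  case 0
  have "z < small.champion_at 0 x"
    using small.iterate.champion_of_active[OF 0] small.active_at_subset z_less by blast
  then have "{c \<in> big.champions_at 0. small.champion_at 0 x \<le> c} =
      {c \<in> small.champions_at 0. small.champion_at 0 x \<le> c}"
    unfolding champions_at_eq by auto
  then show ?case using champion_at_eq[OF 0] by (simp add: champion_rank_def)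
next
  case (Suc i)
  have "small.champion_at (Suc i) x \<in> small.active_at i"
    using small.iterate.champion_of_active[OF Suc.prems] by (rule small.active_if_active_Suc)
  then show ?case using Suc.IH champion_at_eq[OF Suc.prems] by simp
qed

lemma T_of_inserted_old:
  assumes "x \<in> A"
  shows "T_of inserted x = T_of w x"
proof -
  obtain i where i: "x \<in> small.champions_at i" using assms by (rule small.champions_at_exhaust)
  then have "x \<in> big.champions_at i" using champions_at_eq by simp
  then show ?thesis
    using i row_at_eq small.iterate.active_if_champion
    by (simp add: big.T_of_champion small.T_of_champion)
qed

lemma old_cells_iff:
  "(Suc i, k) \<in> T_of w ` A \<longleftrightarrow> (\<exists>c \<in> big.champions_at i. c \<noteq> z \<and> big.row_at i c = k)"
  using small.T_of_image_iff champions_at_eq row_at_eq small.iterate.active_if_champion by auto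

lemma T_of_inserted_before_0:
  assumes "y = 0"
  shows "T_of inserted z = (1, Suc (card {p \<in> T_of w ` A. fst p = 1}))"
proof -
  have z_active: "z \<in> big.active_at 0" using big.active_0 by simp
  have "\<not> precedes w 0 x" for x
    using small.active_0 small.word_set small.iterate.precedence_asym[of 0 0 x]
      small.iterate.precedence_irrefl[of 0 0] precedes_in_set[of w 0 x] by (auto simp: active_def)
  then have "x = 0" if "precedes inserted z x" for x
    using that precedes_insert_before_iff[OF small.word_distinct y_in_word z_notin_word] assms
    by simp
  then have z_champion: "z \<in> big.champions_at 0"
    using z_active big.iterate.zero_not_active[of 0] by (auto simp: champion_set_def)
  then have "{c \<in> big.champions_at 0. z \<le> c} = insert z (small.champions_at 0)"
    using champions_at_eq[of 0] z_le_active[of _ 0] big.iterate.active_if_champion[of _ 0] by auto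
  moreover have "z \<notin> small.champions_at 0" using champions_at_eq by blast
  ultimately have "big.row_at 0 z = Suc (card (small.champions_at 0))"
    using big.iterate.champion_of_self[OF z_champion] small.iterate.finite_champion_set[of 0]
    by (simp add: champion_rank_def)
  then show ?thesis
    using big.T_of_champion[OF z_champion] by (simp add: small.card_champions_at_0[simplified])
qed

lemma initial_row_z_eq_y:
  assumes "y \<noteq> 0"
  shows "big.row_at 0 z = big.row_at 0 y"
proof -
  have y: "y \<in> A" using y_in assms by simp
  have active: "z \<in> active inserted" "y \<in> active inserted" using y big.active_0 by auto
  have follows: "precedes inserted z x \<longleftrightarrow> x = y \<or> precedes inserted y x" if "x \<noteq> z" for x
    using that y z_notin precedes_removeAll[of z inserted y x]
    by (auto simp: precedes_insert_before_iff removeAll_insert_before small.word_distinct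
        y_in_word z_notin_word)
  let ?c = "champion_of inserted z"
  have "champion_of inserted y \<le> ?c"
    using big.iterate.champion_of_antimono[of 0 z y] active follows[of y] y z_less[OF y] by auto
  moreover have "?c \<le> champion_of inserted y"
  proof -
    have "z < ?c"
      using big.iterate.le_champion_of[of y 0 z] active follows[of y] z_less[OF y] by auto
    then show ?thesis
      using big.iterate.champion_of_active[of z 0] big.iterate.champion_of_eq_or_precedes[of z 0]
        big.iterate.le_champion_of[of ?c 0 y] active follows[of ?c] by auto
  qed
  ultimately show ?thesis by simp
qed

lemma addable_new_cell:
  assumes z: "z \<in> big.champions_at (Suc l)"
  shows "addable (T_of w ` A) (Suc (Suc l)) (big.row_at (Suc l) z)"
proof -
  have "big.champion_at l z \<noteq> z"
    using z big.champion_at_champion_Suc big.champions_at_unique by (metis n_not_Suc_n)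
  then have "(Suc l, big.row_at (Suc l) z) \<in> T_of w ` A"
    unfolding old_cells_iff
    using z big.champion_at_champion_Suc big.block_row_champion_at_champion_Suc by blast
  moreover have "(Suc (Suc l), k) \<notin> T_of w ` A" if "big.row_at (Suc l) z \<le> k" for k
  proof
    assume "(Suc (Suc l), k) \<in> T_of w ` A"
    then obtain c where c: "c \<in> big.champions_at (Suc l)" "c \<noteq> z" "big.row_at (Suc l) c = k"
      unfolding old_cells_iff by blast
    then have "c \<le> z"
      using that z big.block_row_le_iff big.iterate.active_if_champion big.iterate.champion_of_self
      by metis
    then show False using c z_le_active big.iterate.active_if_champion by (metis order_antisym)
  qed
  ultimately show ?thesis by (simp add: addable_def)
qed

lemma y_champion_before_z:
  assumes z: "z \<in> big.champions_at (Suc l)" and y: "y \<in> big.champions_at g"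
  shows "g \<le> l"
proof (rule ccontr)
  assume "\<not> g \<le> l"
  then have y_active: "y \<in> big.active_at (Suc l)"
    using big.active_antimono[of "Suc l" g] big.iterate.active_if_champion[OF y] by auto
  have z_active: "z \<in> big.active_at (Suc l)" using z by (rule big.iterate.active_if_champion)
  have "y \<noteq> 0" using y_active big.iterate.zero_not_active by metis
  then have "y \<in> A" using y_in by simp
  have "big.row_at (Suc l) y = big.row_at (Suc l) z"
    using y_active z_active initial_row_z_eq_y[OF \<open>y \<noteq> 0\<close>, symmetric]
    by (rule big.block_row_eq_if_initial_eq)
  then have "big.champion_at (Suc l) y \<le> big.champion_at (Suc l) z"
    using big.block_row_le_iff[OF z_active y_active] by simp
  also have "\<dots> = z" using z by (rule big.iterate.champion_of_self)
  finally show False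
    using big.iterate.le_champion_of[of y "Suc l" y] y_active z_less[OF \<open>y \<in> A\<close>] by simp
qed

lemma T_of_y_in_hook_cells:
  assumes "y \<noteq> 0" and z: "z \<in> big.champions_at (Suc l)"
  shows "T_of w y \<in> hook_cells (T_of w ` A) (Suc (Suc l)) (big.row_at (Suc l) z)"
proof -
  have "y \<in> A" using y_in assms(1) by simp
  then obtain g where y: "y \<in> big.champions_at g" using big.champions_at_exhaust by blast
  have g: "g \<le> l" using z y by (rule y_champion_before_z)
  have z_active: "z \<in> big.active_at (Suc l)" using z by (rule big.iterate.active_if_champion)
  then have "z \<in> big.active_at g" using g big.active_antimono[of g "Suc l"] by auto
  then have row_y: "big.row_at g y = big.row_at g z"
    using big.block_row_eq_if_initial_eq initial_row_z_eq_y[OF assms(1)]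
      big.iterate.active_if_champion[OF y] by metis
  have T_y: "T_of w y = (Suc g, big.row_at g z)"
    using big.T_of_champion[OF y] T_of_inserted_old[OF \<open>y \<in> A\<close>] row_y by simp
  have "big.row_at g z \<le> big.row_at (Suc l) z"
    using g z_active by (intro big.block_row_mono) auto
  moreover have "(Suc l, k) \<notin> T_of w ` A"
    if k: "big.row_at g z \<le> k" "k < big.row_at (Suc l) z" for k
  proof
    assume "(Suc l, k) \<in> T_of w ` A"
    then obtain c where c: "c \<in> big.champions_at l" "big.row_at l c = k"
      unfolding old_cells_iff by blast
    have "big.row_at 0 z \<le> k"
      using big.block_row_mono[OF _ \<open>z \<in> big.active_at g\<close>, of 0] k(1) by simp
    then have "big.row_at l z \<le> k"
      using big.block_row_le_champion_iff[OF big.active_if_active_Suc[OF z_active] c(1)] c(2)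
      by simp
    then show False using big.block_row_Suc_champion[OF z] k(2) by simp
  qed
  moreover have "T_of w y \<in> T_of w ` A" using \<open>y \<in> A\<close> by (rule imageI)
  ultimately show ?thesis using g by (auto simp: hook_cells_def T_y)
qed

lemma T_of_inserted_before_nonzero:
  assumes "y \<noteq> 0" "T_of inserted z = (i, j)"
  shows "addable (T_of w ` A) i j" and "T_of w y \<in> hook_cells (T_of w ` A) i j"
proof -
  have "y \<in> A" using y_in assms(1) by simp
  obtain m where m: "z \<in> big.champions_at m" using big.champions_at_exhaust[of z] by blast
  have "m \<noteq> 0"
  proof
    assume "m = 0"
    moreover have "precedes inserted z y"
      using precedes_insert_before_iff[OF small.word_distinct y_in_word z_notin_word] by simp
    moreover have "y \<in> big.active_at 0" using \<open>y \<in> A\<close> big.active_0 by simp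
    ultimately have "y < z" using m by (simp add: champion_set_def)
    then show False using z_less[OF \<open>y \<in> A\<close>] by simp
  qed
  then obtain l where "m = Suc l" by (cases m) auto
  then show "addable (T_of w ` A) i j" "T_of w y \<in> hook_cells (T_of w ` A) i j"
    using m addable_new_cell T_of_y_in_hook_cells[OF assms(1)] big.T_of_champion[OF m] assms(2)
    by auto
qed

lemma T_of_inserted_iff:
  assumes D: "composition_shape D" and corner: "corner D (i, j)"
    and old: "T_of w ` A = D - {(i, j)}"
  shows "T_of inserted z = (i, j) \<longleftrightarrow> (if i = 1 then y = 0 else y \<noteq> 0 \<and> T_of w y \<in> hook_cells D i j)"
proof (cases "y = 0")
  case True
  have "(i, j) \<in> D" using corner by (simp add: corner_def)
  then have "1 \<le> j" using composition_shape_pos[OF D] by blast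
  have "card {p \<in> T_of w ` A. fst p = 1} = j - 1" if "i = 1"
    using first_column_remove_corner[OF D] corner that unfolding old
    by (simp add: card_image inj_on_def)
  then show ?thesis using T_of_inserted_before_0[OF True] True \<open>1 \<le> j\<close> by auto
next
  case False
  obtain i' j' where new: "T_of inserted z = (i', j')" by fastforce
  note addable = T_of_inserted_before_nonzero(1)[OF False new, unfolded old]
    and hook = T_of_inserted_before_nonzero(2)[OF False new, unfolded old]
  have "(i', j') = (i, j) \<longleftrightarrow> T_of w y \<in> hook_cells (D - {(i, j)}) i j" if "i \<noteq> 1"
    using addable_hooks_disjoint[OF composition_shape_remove_corner[OF D corner] addable
        addable_remove_corner[OF D corner that] hook] hook by auto
  moreover have "i' \<noteq> 1" using addable by (auto simp: addable_def)
  moreover have "hook_cells (D - {(i, j)}) i j = hook_cells D i j"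
    using corner by (intro hook_cells_remove_corner) (auto simp: corner_def)
  ultimately show ?thesis using False new by auto
qed

end

section \<open>Counting\<close>

definition linear_extension_on :: "nat set \<Rightarrow> (nat \<times> nat) set \<Rightarrow> (nat \<Rightarrow> nat \<times> nat) \<Rightarrow> bool" where
  "linear_extension_on A D T \<longleftrightarrow>
     bij_betw T A D \<and> (\<forall>x \<in> A. \<forall>y \<in> A. ge_D (T x) (T y) \<longrightarrow> x \<ge> y)"

lemma linear_extension_on_bij_betw: "linear_extension_on A D T \<Longrightarrow> bij_betw T A D"
  by (simp add: linear_extension_on_def)

definition tableau_words :: "nat set \<Rightarrow> (nat \<Rightarrow> nat \<times> nat) \<Rightarrow> nat list set" where
  "tableau_words A T = {\<pi> \<in> zero_ended_words A. \<forall>x \<in> A. T_of \<pi> x = T x}"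

lemma linear_extension_on_corner:
  assumes "linear_extension_on (insert z A) D T" "\<And>a. a \<in> A \<Longrightarrow> z < a"
  shows "corner D (T z)"
proof -
  have bij: "bij_betw T (insert z A) D" using assms(1) by (rule linear_extension_on_bij_betw)
  have "q = T z" if q: "q \<in> D" "ge_D (T z) q" for q
  proof -
    obtain x where x: "x \<in> insert z A" "q = T x" using q(1) bij by (auto simp: bij_betw_def)
    then have "x \<le> z" using assms(1) q(2) by (auto simp: linear_extension_on_def)
    then have "x = z" using assms(2)[of x] x(1) by auto
    then show ?thesis using x(2) by simp
  qed
  moreover have "T z \<in> D" using bij by (auto simp: bij_betw_def)
  ultimately show ?thesis by (simp add: corner_def)
qed

lemma linear_extension_on_remove:
  assumes "linear_extension_on (insert z A) D T" "z \<notin> A"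
  shows "linear_extension_on A (D - {T z}) T"
proof -
  have "bij_betw T (insert z A) D" using assms(1) by (rule linear_extension_on_bij_betw)
  then have "bij_betw T A (D - {T z})"
    using assms(2) by (auto simp: bij_betw_def)
  then show ?thesis using assms(1) by (simp add: linear_extension_on_def)
qed

definition insertion_sites ::
    "nat set \<Rightarrow> (nat \<times> nat) set \<Rightarrow> (nat \<Rightarrow> nat \<times> nat) \<Rightarrow> nat \<Rightarrow> nat \<Rightarrow> nat set" where
  "insertion_sites A D T i j = (if i = 1 then {0} else {y \<in> A. T y \<in> hook_cells D i j})"

lemma card_insertion_sites:
  assumes "bij_betw T A (D - {(i, j)})"
  shows "card (insertion_sites A D T i j) = hook_number D i j"
proof (cases "i = 1")
  case False
  have "bij_betw T {y \<in> A. T y \<in> hook_cells D i j} {p \<in> D - {(i, j)}. p \<in> hook_cells D i j}"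
    using assms by (rule bij_betw_Collect) simp
  moreover have "{p \<in> D - {(i, j)}. p \<in> hook_cells D i j} = hook_cells D i j"
    by (auto simp: hook_cells_def)
  ultimately show ?thesis
    using False by (simp add: insertion_sites_def hook_number_def bij_betw_same_card)
qed (simp add: insertion_sites_def hook_number_def)

lemma insert_before_tableau_words_iff:
  assumes D: "composition_shape D" "corner D (i, j)" and bij: "bij_betw T A (D - {(i, j)})"
    and A: "0 \<notin> insert z A" "\<And>a. a \<in> A \<Longrightarrow> z < a" and Tz: "T z = (i, j)"
    and w: "w \<in> zero_ended_words A" and y: "y \<in> insert 0 A"
  shows "insert_before z y w \<in> tableau_words (insert z A) T \<longleftrightarrow>
    w \<in> tableau_words A T \<and> y \<in> insertion_sites A D T i j"
proof -
  interpret min_insertion A w z y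
    using w y A by unfold_locales auto
  have "(\<forall>x \<in> A. T_of inserted x = T x) \<longleftrightarrow> (\<forall>x \<in> A. T_of w x = T x)"
    using T_of_inserted_old by simp
  moreover have "T_of inserted z = T z \<longleftrightarrow> y \<in> insertion_sites A D T i j"
    if "\<forall>x \<in> A. T_of w x = T x"
  proof -
    have "T_of w ` A = D - {(i, j)}"
      using that bij unfolding bij_betw_def by (metis image_cong)
    then show ?thesis
      using T_of_inserted_iff[OF D] that y A(1) by (auto simp: Tz insertion_sites_def)
  qed
  ultimately show ?thesis using w big.word by (auto simp: tableau_words_def)
qed

lemma card_tableau_words_insert:
  assumes D: "composition_shape D" and T: "linear_extension_on (insert z A) D T"
    and A: "0 \<notin> insert z A" "\<And>a. a \<in> A \<Longrightarrow> z < a" and Tz: "T z = (i, j)"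
  shows "card (tableau_words (insert z A) T) = card (tableau_words A T) * hook_number D i j"
proof -
  let ?sites = "insertion_sites A D T i j"
  have z: "z \<noteq> 0" "z \<notin> A" using A by auto
  have corner: "corner D (i, j)"
    using linear_extension_on_corner[OF T A(2)] by (simp add: Tz)
  have bij: "bij_betw T A (D - {(i, j)})"
    using linear_extension_on_bij_betw[OF linear_extension_on_remove[OF T z(2)]] by (simp add: Tz)
  have "bij_betw (\<lambda>(w, y). insert_before z y w)
      {p \<in> zero_ended_words A \<times> insert 0 A. p \<in> tableau_words A T \<times> ?sites}
      {u \<in> zero_ended_words (insert z A). u \<in> tableau_words (insert z A) T}"
    using insert_before_tableau_words_iff[OF D corner bij A Tz]
    by (intro bij_betw_Collect[OF bij_betw_insert_before[OF z]]) auto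
  moreover have "{p \<in> zero_ended_words A \<times> insert 0 A. p \<in> tableau_words A T \<times> ?sites} =
      tableau_words A T \<times> ?sites"
    by (auto simp: tableau_words_def insertion_sites_def split: if_splits)
  moreover have "{u \<in> zero_ended_words (insert z A). u \<in> tableau_words (insert z A) T} =
      tableau_words (insert z A) T"
    by (auto simp: tableau_words_def)
  ultimately have "card (tableau_words (insert z A) T) = card (tableau_words A T \<times> ?sites)"
    by (simp add: bij_betw_same_card[symmetric])
  then show ?thesis using card_insertion_sites[OF bij] by (simp add: card_cartesian_product)
qed

lemma tableau_words_empty: "tableau_words {} T = {[0]}"
proof -
  have "\<pi> = [0]" if "distinct \<pi>" "set \<pi> = {0}" for \<pi> :: "nat list"
    using that by (cases \<pi>) (auto simp: subset_singleton_iff)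
  then show ?thesis by (auto simp: tableau_words_def zero_ended_words_def)
qed

lemma card_tableau_words:
  assumes "finite A" "0 \<notin> A" "composition_shape D" "linear_extension_on A D T"
  shows "card (tableau_words A T) = (\<Prod>(i, j) \<in> D. hook_number D i j)"
  using assms
proof (induction A arbitrary: D rule: finite_linorder_min_induct)
  case empty
  then have "D = {}" using linear_extension_on_bij_betw by (fastforce simp: bij_betw_def)
  then show ?case by (simp add: tableau_words_empty)
next
  case (insert z A)
  obtain i j where Tz: "T z = (i, j)" by fastforce
  have corner: "corner D (i, j)"
    using linear_extension_on_corner[of z A D T] insert.hyps insert.prems by (simp add: Tz)
  have "linear_extension_on A (D - {(i, j)}) T"
    using linear_extension_on_remove[of z A D T] insert.hyps insert.prems by (auto simp: Tz)
  then have "card (tableau_words A T) = (\<Prod>(a, b) \<in> D - {(i, j)}. hook_number (D - {(i, j)}) a b)"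
    using insert.prems composition_shape_remove_corner[OF _ corner] by (intro insert.IH) auto
  also have "\<dots> = (\<Prod>(a, b) \<in> D - {(i, j)}. hook_number D a b)"
    using hook_number_remove_corner[OF corner] by (intro prod.cong) auto
  finally have "card (tableau_words (insert z A) T) =
      (\<Prod>(a, b) \<in> D - {(i, j)}. hook_number D a b) * hook_number D i j"
    using card_tableau_words_insert[of D z A T i j] insert.hyps insert.prems Tz by simp
  also have "\<dots> = (\<Prod>(a, b) \<in> D. hook_number D a b)"
    using corner composition_shape_finite[OF insert.prems(2)]
    by (simp add: corner_def prod.remove[of D "(i, j)"])
  finally show ?case .
qed

section \<open>Composition diagrams\<close>

lemma composition_shape_diagram:
  assumes "composition_of \<alpha> n" "finite (diagram \<alpha>)"
  shows "composition_shape (diagram \<alpha>)"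
  unfolding composition_shape_def
proof (intro conjI allI impI)
  fix j j' assume "(1, j) \<in> diagram \<alpha>" "1 \<le> j'" "j' \<le> j"
  then have "1 \<le> j'" "j' \<le> length \<alpha>" by (auto simp: diagram_def)
  moreover from this have "\<alpha> ! (j' - 1) \<in> set \<alpha>" by (intro nth_mem) auto
  ultimately show "(1, j') \<in> diagram \<alpha>"
    using assms(1) by (auto simp: diagram_def composition_of_def)
qed (use assms(2) in \<open>auto simp: diagram_def\<close>)

lemma hook_bound_less_iff:
  assumes "(i, j) \<in> diagram \<alpha>" "i \<noteq> 1" "1 \<le> j'"
  shows "hook_bound \<alpha> i j < j' \<longleftrightarrow> (\<forall>k \<in> {j'..<j}. (i - 1, k) \<notin> diagram \<alpha>)"
proof -
  define R where "R = {j'. 1 \<le> j' \<and> j' < j \<and> \<alpha> ! (j' - 1) \<ge> i - 1}"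
  have R: "k \<in> R \<longleftrightarrow> k < j \<and> (i - 1, k) \<in> diagram \<alpha>" for k
    using assms(1,2) by (auto simp: R_def diagram_def)
  have "finite R" by (rule finite_subset[of _ "{..<j}"]) (auto simp: R_def)
  then have "hook_bound \<alpha> i j < j' \<longleftrightarrow> (\<forall>k \<in> R. k < j')"
    unfolding hook_bound_def R_def[symmetric] Let_def using assms(3) by auto
  then show ?thesis by (auto simp: R not_less[symmetric])
qed

lemma hook_eq_hook_number:
  assumes "(i, j) \<in> diagram \<alpha>"
  shows "hook \<alpha> i j = hook_number (diagram \<alpha>) i j"
proof (cases "i = 1")
  case False
  have "i' \<le> i - 1 \<and> hook_bound \<alpha> i j < j' \<and> j' \<le> j \<longleftrightarrow>
      i' < i \<and> j' \<le> j \<and> (\<forall>k \<in> {j'..<j}. (i - 1, k) \<notin> diagram \<alpha>)"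
    if "(i', j') \<in> diagram \<alpha>" for i' j'
    using hook_bound_less_iff[OF assms False, of j'] that assms by (auto simp: diagram_def)
  then have "{(i', j') \<in> diagram \<alpha>. i' \<le> i - 1 \<and> hook_bound \<alpha> i j < j' \<and> j' \<le> j} =
      hook_cells (diagram \<alpha>) i j"
    unfolding hook_cells_def by blast
  then show ?thesis using False by (simp add: hook_def hook_number_def)
qed (simp add: hook_def hook_number_def)

lemma S'_eq_zero_ended_words: "S' n = zero_ended_words {1..n}"
proof -
  have "{0..n} = insert 0 {1..n}" by auto
  then show ?thesis
    unfolding S'_def zero_ended_words_def permutations_of_set_def by blast
qed

lemma card_first_column_diagram:
  assumes "composition_of \<alpha> n"
  shows "card {p \<in> diagram \<alpha>. fst p = 1} = length \<alpha>"
proof -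
  have "{p \<in> diagram \<alpha>. fst p = 1} = Pair 1 ` {1..length \<alpha>}"
    using assms by (auto simp: diagram_def composition_of_def)
  then show ?thesis by (simp add: card_image inj_on_def)
qed

lemma card_row_diagram:
  assumes "j < length \<alpha>"
  shows "card {p \<in> diagram \<alpha>. snd p = Suc j} = \<alpha> ! j"
proof -
  have "{p \<in> diagram \<alpha>. snd p = Suc j} = (\<lambda>i. (i, Suc j)) ` {1..\<alpha> ! j}"
    using assms by (auto simp: diagram_def)
  then show ?thesis by (simp add: card_image inj_on_def)
qed

lemma alpha_eq_if_bij_betw_T_of:
  assumes "composition_of \<alpha> n" and word: "\<pi> \<in> zero_ended_words {1..n}"
    and bij: "bij_betw (T_of \<pi>) {1..n} (diagram \<alpha>)"
  shows "alpha \<pi> = \<alpha>"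
proof -
  interpret zero_ended "{1..n}" \<pi> using word by unfold_locales auto
  have "length (C_seq \<pi> 1) = length \<alpha>"
    using length_C_seq_1 bij card_first_column_diagram[OF assms(1)] by (simp add: bij_betw_def)
  moreover have "length \<pi> - 1 = n"
    using distinct_card[OF word_distinct] word_set by simp
  moreover have "card {x \<in> {1..n}. row \<pi> x = Suc j} = \<alpha> ! j" if "j < length \<alpha>" for j
  proof -
    have "bij_betw (T_of \<pi>) {x \<in> {1..n}. row \<pi> x = Suc j} {p \<in> diagram \<alpha>. snd p = Suc j}"
      using bij by (rule bij_betw_Collect) (simp add: T_of_def)
    then show ?thesis using card_row_diagram[OF that] by (simp add: bij_betw_same_card)
  qed
  ultimately show ?thesis
    unfolding alpha_def by (intro nth_equalityI) (auto simp del: upt_Suc)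
qed

theorem theorem4p10:
  fixes n :: nat and \<alpha> :: "nat list" and T :: "nat \<Rightarrow> nat \<times> nat"
  assumes "composition_of \<alpha> n"
    and "linear_extension n \<alpha> T"
  shows "card {\<pi> \<in> S' n. alpha \<pi> = \<alpha> \<and> (\<forall>x \<in> {1..n}. T_of \<pi> x = T x)}
    = (\<Prod>(i, j) \<in> diagram \<alpha>. hook \<alpha> i j)"
proof -
  have T: "linear_extension_on {1..n} (diagram \<alpha>) T"
    using assms(2) unfolding linear_extension_def linear_extension_on_def .
  then have bij: "bij_betw T {1..n} (diagram \<alpha>)" by (rule linear_extension_on_bij_betw)
  then have shape: "composition_shape (diagram \<alpha>)"
    using composition_shape_diagram[OF assms(1)] bij_betw_finite by blast
  have "alpha \<pi> = \<alpha>" if "\<pi> \<in> zero_ended_words {1..n}" "\<forall>x \<in> {1..n}. T_of \<pi> x = T x" for \<pi>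
    using alpha_eq_if_bij_betw_T_of[OF assms(1) that(1)] bij that(2)
      bij_betw_cong[of "{1..n}" "T_of \<pi>" T] by metis
  then have "{\<pi> \<in> S' n. alpha \<pi> = \<alpha> \<and> (\<forall>x \<in> {1..n}. T_of \<pi> x = T x)} = tableau_words {1..n} T"
    by (auto simp: tableau_words_def S'_eq_zero_ended_words)
  also have "card \<dots> = (\<Prod>(i, j) \<in> diagram \<alpha>. hook_number (diagram \<alpha>) i j)"
    using shape T by (intro card_tableau_words) auto
  also have "\<dots> = (\<Prod>(i, j) \<in> diagram \<alpha>. hook \<alpha> i j)"
    using hook_eq_hook_number by (intro prod.cong) auto
  finally show ?thesis .
qed

end
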